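(* Let $Y=\mu+\xi$ with $\mu\in\mathbb{R}^n$, $\xi\sim\mathcal{N}(0,\sigma^2I_n)$, let $X_1,\dots,X_p\in\mathbb{R}^n$ be given vectors with $n\times p$ design matrix $\mathbb{X}=[X_1,\dots,X_p]$, let $\hat\mu_J=A_JY$, $J\subset[p]$, be the least squares estimators and $\pi$ the sparsity prior (both defined in the context), and fix $\delta>0$. Then: (i) For $\lambda\ge20\sigma^2$, with probability at least $1-\delta$, the $Q$-aggregate estimator $\hat\mu^Q$ (with $\nu=1/2$) satisfies $$\|\hat\mu^Q-\mu\|^2\le\min_{\beta\in\mathbb{R}^p}\Big\{\|\mathbb{X}\beta-\mu\|^2+3(\lambda+2\sigma^2)|\beta|_0\log\Big(\frac{2ep}{|\beta|_0\delta}\Big)\Big\}.$$ (ii) For $\lambda\ge64\sigma^2$, with probability at least $1-\delta$, the aggregate with exponential weights $\hat\mu^{\mathsf{EW}}$ satisfies $$\|\hat\mu^{\mathsf{EW}}-\mu\|^2\le\min_{\beta\in\mathbb{R}^p}\Big\{\Big(1+\frac{128\sigma^2}{3\lambda}\Big)\|\mathbb{X}\beta-\mu\|^2+6(\lambda+2\sigma^2)|\beta|_0\log\Big(\frac{2ep}{|\beta|_0\delta}\Big)\Big\}.$$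
   Context: $[p]=\{1,\dots,p\}$; $\|\cdot\|$ is the Euclidean norm; $\mu$ is deterministic and unknown, $\sigma^2>0$ known. For $\beta\in\mathbb{R}^p\setminus\{0\}$, $|\beta|_0$ is the number of nonzero coefficients of $\beta$, and by convention $|0|_0=1$. For $J\subset[p]$, $\mathbb{X}_J$ is the $n\times|J|$ matrix with columns $X_j$, $j\in J$, and $A_J=\mathbb{X}_J(\mathbb{X}_J^\top\mathbb{X}_J)^\dagger\mathbb{X}_J^\top$ is the orthogonal projection onto the span of $\{X_j\}_{j\in J}$ ($^\dagger$ denotes the Moore–Penrose pseudoinverse; $A_\emptyset=0$). Put $C_J=4\sigma^2\,\mathrm{Tr}(A_J)=4\sigma^2\,\mathrm{rank}(\mathbb{X}_J)$. The sparsity prior is the probability distribution on subsets of $[p]$ with $\pi_J\propto e^{-|J|}/\binom{p}{|J|}$. Let $\Lambda$ be the set of probability vectors $\theta=(\theta_J)_{J\subset[p]}$, $\mu_\theta=\sum_J\theta_J\hat\mu_J$, and $\mathcal{K}(\theta,\pi)=\sum_J\theta_J\log(\theta_J/\pi_J)$ (with $0\log0=0$). The $Q$-aggregate estimator with parameters $\nu\in(0,1)$, $\lambda>0$ is $\hat\mu^Q=\mu_{\hat\theta}$, $\hat\theta\in\mathrm{argmin}_{\theta\in\Lambda}Q(\theta)$, where $$Q(\theta)=\nu\sum_J\theta_J\|Y-\hat\mu_J\|^2+(1-\nu)\|Y-\mu_\theta\|^2+\sum_J\theta_JC_J+\lambda\mathcal{K}(\theta,\pi);$$ here $\nu=1/2$.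 The aggregate with exponential weights with parameter $\lambda$ is $\hat\mu^{\mathsf{EW}}=\sum_J\hat\theta_J\hat\mu_J$ with $\hat\theta\in\Lambda$, $\hat\theta_J\propto\pi_J\exp\big(-(\|Y-\hat\mu_J\|^2+C_J)/\lambda\big)$. *)

theory Defs
  imports "HOL-Probability.Probability"
begin

definition is_pinv :: "real^'m^'n \<Rightarrow> real^'n^'m \<Rightarrow> bool" where
  "is_pinv A B \<longleftrightarrow>
     A ** B ** A = A \<and> B ** A ** B = B \<and>
     transpose (A ** B) = A ** B \<and> transpose (B ** A) = B ** A"

text \<open>The Moore--Penrose pseudoinverse; the lemma \<open>pinv\<close> below shows that it exists.\<close>
definition pinv :: "real^'m^'n \<Rightarrow> real^'n^'m" where
  "pinv A = (THE B. is_pinv A B)"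

lemma is_pinv_unique:
  assumes B: "is_pinv A B" and C: "is_pinv A C"
  shows "B = C"
proof -
  have "A ** B = transpose (A ** C ** A ** B)"
    using B C unfolding is_pinv_def by metis
  also have "\<dots> = transpose (A ** B) ** transpose (A ** C)"
    by (simp add: matrix_transpose_mul[symmetric] matrix_mul_assoc)
  also have "\<dots> = A ** B ** A ** C"
    using B C unfolding is_pinv_def by (metis matrix_mul_assoc)
  finally have AB: "A ** B = A ** C"
    using B unfolding is_pinv_def by metis
  have "B ** A = transpose (B ** A ** C ** A)"
    using B C unfolding is_pinv_def by (metis matrix_mul_assoc)
  also have "\<dots> = transpose (C ** A) ** transpose (B ** A)"
    by (simp add: matrix_transpose_mul[symmetric] matrix_mul_assoc)
  also have "\<dots> = C ** A ** B ** A"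
    using B C unfolding is_pinv_def by (metis matrix_mul_assoc)
  finally have BA: "B ** A = C ** A"
    using B unfolding is_pinv_def by (metis matrix_mul_assoc)
  have "B = B ** A ** B" using B unfolding is_pinv_def by metis
  also have "\<dots> = C ** A ** C" using AB BA by (metis matrix_mul_assoc)
  finally show ?thesis using C unfolding is_pinv_def by metis
qed

lemma is_pinv_exists:
  fixes A :: "real^'m^'n"
  shows "\<exists>B. is_pinv A B"
proof -
  define T where "T = range ((*v) (transpose A))"
  have subT: "subspace T"
    unfolding T_def by (intro linear_subspace_image subspace_UNIV matrix_vector_mul_linear)
  have subA: "subspace (range ((*v) A))"
    by (intro linear_subspace_image subspace_UNIV matrix_vector_mul_linear)
  have adj: "inner (A *v x) y = inner x (transpose A *v y)" for x :: "real^'m" and y :: "real^'n"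
    by (metis dot_lmul_matrix inner_commute transpose_matrix_vector)
  have ker: "A *v z = 0" if "transpose A *v (A *v z) = 0" for z
    using adj[of z "A *v z"] that by simp
  have uniq: "x = x'"
    if "x \<in> T" "x' \<in> T" "A *v x = A *v x'" for x x'
  proof -
    have "x - x' \<in> T" using that subT subspace_diff by blast
    then obtain w where w: "x - x' = transpose A *v w" unfolding T_def by blast
    have "A *v (x - x') = 0" using that by (simp add: matrix_vector_mult_diff_distrib)
    then have "inner (x - x') (x - x') = 0" using adj[of "x - x'" w] w by simp
    then show ?thesis by simp
  qed
  have ex: "\<exists>x\<in>T. \<forall>u. inner (y - A *v x) (A *v u) = 0" for y
  proof -
    obtain a b where ab: "a \<in> range ((*v) A)" "y = a + b"
        "\<And>w. w \<in> range ((*v) A) \<Longrightarrow> orthogonal b w"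
      using orthogonal_subspace_decomp_exists[of "range ((*v) A)" y]
        span_eq_iff[THEN iffD2, OF subA] by metis
    obtain w where w: "a = A *v w" using ab by blast
    obtain c d where cd: "c \<in> T" "w = c + d" "\<And>v. v \<in> T \<Longrightarrow> orthogonal d v"
      using orthogonal_subspace_decomp_exists[of T w] span_eq_iff[THEN iffD2, OF subT] by metis
    have "inner d (transpose A *v (A *v d)) = 0"
      using cd(3) unfolding T_def orthogonal_def by blast
    then have "A *v d = 0" using adj[of d "A *v d"] by simp
    then have "a = A *v c" using w cd by (simp add: matrix_vector_right_distrib)
    then show ?thesis using ab cd(1) by (intro bexI[of _ c]) (auto simp: orthogonal_def)
  qed
  obtain g where gT: "\<And>y. g y \<in> T" and g: "\<And>y u. inner (y - A *v g y) (A *v u) = 0"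
    using ex by metis
  have gI: "g y = x" if "x \<in> T" "\<And>u. inner (y - A *v x) (A *v u) = 0" for x y
  proof (rule uniq[OF gT that(1)])
    let ?u = "g y - x"
    have "inner (A *v ?u) (A *v ?u) = inner (y - A *v x) (A *v ?u) - inner (y - A *v g y) (A *v ?u)"
      by (simp add: inner_diff_left matrix_vector_mult_diff_distrib)
    also have "\<dots> = 0" using that(2) g by simp
    finally show "A *v g y = A *v x" by (simp add: matrix_vector_mult_diff_distrib)
  qed
  have lin: "linear g"
  proof (rule linearI)
    fix y z show "g (y + z) = g y + g z"
    proof (rule gI)
      fix u
      have "inner (y - A *v g y) (A *v u) + inner (z - A *v g z) (A *v u) = 0"
        using g by simp
      then show "inner (y + z - A *v (g y + g z)) (A *v u) = 0"
        by (simp add: matrix_vector_right_distrib inner_diff_left inner_add_left)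
    qed (use gT subT subspace_add in blast)
  next
    fix c :: real and y show "g (c *\<^sub>R y) = c *\<^sub>R g y"
    proof (rule gI)
      fix u
      have "c * inner (y - A *v g y) (A *v u) = 0" using g by simp
      then show "inner (c *\<^sub>R y - A *v (c *\<^sub>R g y)) (A *v u) = 0"
        by (simp add: matrix_vector_mult_scaleR inner_diff_left algebra_simps)
    qed (use gT subT subspace_scale in blast)
  qed
  define B where "B = matrix g"
  have B: "B *v y = g y" for y unfolding B_def using lin by (simp add: matrix_works)
  have AgA: "A *v g (A *v x) = A *v x" for x
  proof -
    let ?u = "x - g (A *v x)"
    have "inner (A *v ?u) (A *v ?u) = 0"
      using g[of "A *v x" ?u] by (simp add: matrix_vector_mult_diff_distrib)
    then show ?thesis by (simp add: matrix_vector_mult_diff_distrib)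
  qed
  have gAg: "g (A *v g y) = g y" for y
    by (rule uniq) (use gT AgA in auto)
  have symAg: "inner (A *v g y) z = inner y (A *v g z)" for y z
    using g[of y "g z"] g[of z "g y"]
    inner_commute[of "A *v g y" "A *v g z"] inner_commute[of "A *v g y" z]
    by (simp add: inner_diff_left)
  have orth: "inner (z - g (A *v z)) (g y) = 0" for y z
  proof -
    obtain w where w: "g y = transpose A *v w" using gT[of y] unfolding T_def by blast
    have "A *v (z - g (A *v z)) = 0" using AgA by (simp add: matrix_vector_mult_diff_distrib)
    then show ?thesis using adj[of "z - g (A *v z)" w] w by simp
  qed
  have symgA: "inner (g (A *v x)) z = inner x (g (A *v z))" for x z
    using orth[of z "A *v x"] orth[of x "A *v z"]
    inner_commute[of "g (A *v x)" "g (A *v z)"] inner_commute[of "g (A *v x)" z]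
    by (simp add: inner_diff_left)
  have symI: "transpose P = P" if "\<And>x y. inner (P *v x) y = inner x (P *v y)"
    for P :: "real^'k^'k"
  proof -
    have "inner x (transpose P *v y) = inner x (P *v y)" for x y
      using that by (metis dot_lmul_matrix inner_commute transpose_matrix_vector)
    then have "transpose P *v y = P *v y" for y
      using vector_eq_ldot[of "transpose P *v y" "P *v y"] by blast
    then show ?thesis unfolding matrix_eq by blast
  qed
  have "A ** B ** A = A" "B ** A ** B = B"
    unfolding matrix_eq by (simp_all add: matrix_vector_mul_assoc[symmetric] B AgA gAg)
  moreover have "transpose (A ** B) = A ** B"
    by (rule symI) (simp only: matrix_vector_mul_assoc[symmetric] B symAg)
  moreover have "transpose (B ** A) = B ** A"
    by (rule symI) (simp only: matrix_vector_mul_assoc[symmetric] B symgA)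
  ultimately show ?thesis unfolding is_pinv_def by blast
qed

lemma pinv: "is_pinv A (pinv A)"
  unfolding pinv_def by (rule theI') (use is_pinv_exists is_pinv_unique in blast)

text \<open>
  The design matrix is \<open>X :: real^'p^'n\<close>, with columns indexed by \<open>'p\<close>, so subsets of
  the columns are sets \<open>J :: 'p set\<close>. The \<open>n \<times> |J|\<close> matrix of the columns in \<open>J\<close> is
  represented by the \<open>n \<times> p\<close> matrix in which the columns outside \<open>J\<close> are zeroed. The Gram
  matrix and its pseudoinverse then acquire only zero rows and columns, so \<open>proj_mat X J\<close>
  is unaffected by this padding.
\<close>
definition sub_cols :: "real^'p^'n \<Rightarrow> 'p set \<Rightarrow> real^'p^'n" where
  "sub_cols X J = (\<chi> i j. if j \<in> J then X $ i $ j else 0)"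

definition proj_mat :: "real^'p^'n \<Rightarrow> 'p set \<Rightarrow> real^'n^'n" where
  "proj_mat X J =
     (let Z = sub_cols X J in Z ** pinv (transpose Z ** Z) ** transpose Z)"

lemma sub_cols_mult: "sub_cols X J *v b = (\<Sum>j\<in>J. b $ j *\<^sub>R column j X)"
proof -
  have "(\<Sum>j\<in>UNIV. (if j \<in> J then X $ i $ j else 0) * b $ j) = (\<Sum>j\<in>J. b $ j * X $ i $ j)" for i
    by (rule sum.mono_neutral_cong_right) auto
  then show ?thesis
    by (simp add: vec_eq_iff sub_cols_def matrix_vector_mult_def column_def)
qed

lemma proj_mat_orthogonal_projection:
  fixes X :: "real^'p^'n"
  shows "proj_mat X J *v y \<in> span ((\<lambda>j. column j X) ` J)"
    and "z \<in> span ((\<lambda>j. column j X) ` J) \<Longrightarrow> inner (y - proj_mat X J *v y) z = 0"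
proof -
  define Z where "Z = sub_cols X J"
  define G where "G = transpose Z ** Z"
  define H where "H = pinv G"
  have P: "proj_mat X J = Z ** H ** transpose Z"
    by (simp add: proj_mat_def Let_def Z_def G_def H_def)
  have "proj_mat X J *v y = Z *v (H *v (transpose Z *v y))"
    by (simp add: P matrix_vector_mul_assoc[symmetric])
  then show "proj_mat X J *v y \<in> span ((\<lambda>j. column j X) ` J)"
    unfolding Z_def sub_cols_mult by (metis (no_types, lifting) imageI span_base span_scale span_sum)
  have adj: "inner (Z *v x) w = inner x (transpose Z *v w)" for x :: "real^'p" and w :: "real^'n"
    by (metis dot_lmul_matrix inner_commute transpose_matrix_vector)
  have ginv: "G *v (H *v (G *v x)) = G *v x" for x
    using pinv[of G] unfolding H_def is_pinv_def by (metis matrix_vector_mul_assoc)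
  have PZ: "Z *v (H *v (transpose Z *v (Z *v x))) = Z *v x" for x
  proof -
    let ?u = "H *v (G *v x) - x"
    have "transpose Z *v (Z *v ?u) = G *v ?u" by (simp only: G_def matrix_vector_mul_assoc)
    also have "\<dots> = 0" using ginv by (simp add: matrix_vector_mult_diff_distrib)
    finally have "Z *v ?u = 0" using adj[of ?u "Z *v ?u"] by simp
    then have "Z *v (H *v (G *v x)) = Z *v x" by (simp add: matrix_vector_mult_diff_distrib)
    then show ?thesis by (simp only: G_def matrix_vector_mul_assoc[symmetric])
  qed
  have key: "inner (y - proj_mat X J *v y) (Z *v b) = 0" for b
  proof -
    have tG: "transpose G = G" by (simp add: G_def matrix_transpose_mul)
    have "is_pinv G (transpose H)"
      using pinv[of G] tG unfolding H_def is_pinv_def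
      by (metis matrix_mul_assoc matrix_transpose_mul)
    then have tH: "transpose H = H"
      using pinv[of G] is_pinv_unique unfolding H_def by blast
    have tP: "transpose (proj_mat X J) = proj_mat X J"
      using tH by (simp add: P matrix_transpose_mul matrix_mul_assoc)
    have "inner (proj_mat X J *v y) (Z *v b) = inner y (proj_mat X J *v (Z *v b))"
      using tP by (metis dot_lmul_matrix transpose_matrix_vector)
    also have "proj_mat X J *v (Z *v b) = Z *v b"
      using PZ by (simp add: P matrix_vector_mul_assoc[symmetric] del: transpose_matrix_vector)
    finally show ?thesis by (simp add: inner_diff_left)
  qed
  have "span ((\<lambda>j. column j X) ` J) \<subseteq> range ((*v) Z)"
  proof (rule span_minimal)
    show "subspace (range ((*v) Z))"
      by (intro linear_subspace_image subspace_UNIV matrix_vector_mul_linear)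
    show "(\<lambda>j. column j X) ` J \<subseteq> range ((*v) Z)"
    proof clarify
      fix j assume "j \<in> J"
      have "Z *v axis j 1 = (\<Sum>i\<in>J. if i = j then column i X else 0)"
        unfolding Z_def sub_cols_mult by (intro sum.cong) (auto simp: axis_def)
      also have "\<dots> = column j X" using \<open>j \<in> J\<close> by simp
      finally show "column j X \<in> range ((*v) Z)" by (metis rangeI)
    qed
  qed
  then show "inner (y - proj_mat X J *v y) z = 0"
    if "z \<in> span ((\<lambda>j. column j X) ` J)"
    using that key by blast
qed

definition lse :: "real^'p^'n \<Rightarrow> real^'n \<Rightarrow> 'p set \<Rightarrow> real^'n" where
  "lse X y J = proj_mat X J *v y"

definition lse_pen :: "real \<Rightarrow> real^'p^'n \<Rightarrow> 'p set \<Rightarrow> real" where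
  "lse_pen \<sigma> X J = 4 * \<sigma>\<^sup>2 * trace (proj_mat X J)"

definition sparsity_prior :: "('p::finite) set \<Rightarrow> real" where
  "sparsity_prior J =
     (exp (- real (card J)) / real (CARD('p) choose card J)) /
     (\<Sum>K\<in>UNIV. exp (- real (card (K :: 'p set))) / real (CARD('p) choose card K))"

definition prob_vectors :: "(('p::finite) set \<Rightarrow> real) set" where
  "prob_vectors = {\<theta>. (\<forall>J. 0 \<le> \<theta> J) \<and> (\<Sum>J\<in>UNIV. \<theta> J) = 1}"

definition aggregate :: "real^'p^'n \<Rightarrow> real^'n \<Rightarrow> ('p set \<Rightarrow> real) \<Rightarrow> real^'n" where
  "aggregate X y \<theta> = (\<Sum>J\<in>UNIV. \<theta> J *\<^sub>R lse X y J)"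

text \<open>Terms with \<open>\<theta> J = 0\<close> vanish because of the factor \<open>\<theta> J\<close>.\<close>
definition KL :: "(('p::finite) set \<Rightarrow> real) \<Rightarrow> ('p set \<Rightarrow> real) \<Rightarrow> real" where
  "KL \<theta> \<pi> = (\<Sum>J\<in>UNIV. \<theta> J * ln (\<theta> J / \<pi> J))"

definition Q_crit ::
    "real \<Rightarrow> real \<Rightarrow> real \<Rightarrow> real^'p^'n \<Rightarrow> real^'n \<Rightarrow> ('p set \<Rightarrow> real) \<Rightarrow> real" where
  "Q_crit \<nu> lam \<sigma> X y \<theta> =
     \<nu> * (\<Sum>J\<in>UNIV. \<theta> J * (norm (y - lse X y J))\<^sup>2)
     + (1 - \<nu>) * (norm (y - aggregate X y \<theta>))\<^sup>2
     + (\<Sum>J\<in>UNIV. \<theta> J * lse_pen \<sigma> X J)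
     + lam * KL \<theta> sparsity_prior"

definition Q_weights ::
    "real \<Rightarrow> real \<Rightarrow> real \<Rightarrow> real^'p^'n \<Rightarrow> real^'n \<Rightarrow> ('p set \<Rightarrow> real) set" where
  "Q_weights \<nu> lam \<sigma> X y =
     {\<theta>. is_arg_min (Q_crit \<nu> lam \<sigma> X y) (\<lambda>\<theta>. \<theta> \<in> prob_vectors) \<theta>}"

definition EW_weights ::
    "real \<Rightarrow> real \<Rightarrow> real^'p^'n \<Rightarrow> real^'n \<Rightarrow> 'p set \<Rightarrow> real" where
  "EW_weights lam \<sigma> X y J =
     (let w = (\<lambda>K. sparsity_prior K *
                 exp (- ((norm (y - lse X y K))\<^sup>2 + lse_pen \<sigma> X K) / lam))
      in w J / (\<Sum>K\<in>UNIV. w K))"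

text \<open>Number of nonzero coefficients, with the convention that it is 1 for the zero vector.\<close>
definition l0 :: "real^'p \<Rightarrow> real" where
  "l0 \<beta> = (if \<beta> = 0 then 1 else real (card {j. \<beta> $ j \<noteq> 0}))"

text \<open>The law \<open>N(0, \<sigma>\<^sup>2 I)\<close>: independent \<open>N(0, \<sigma>\<^sup>2)\<close> coordinates
  (\<^const>\<open>normal_density\<close> takes the standard deviation).\<close>
definition iso_normal :: "'a measure \<Rightarrow> real \<Rightarrow> ('a \<Rightarrow> real^'n) \<Rightarrow> bool" where
  "iso_normal M \<sigma> \<xi> \<longleftrightarrow>
     prob_space.indep_vars M (\<lambda>_. borel) (\<lambda>i \<omega>. \<xi> \<omega> $ i) UNIV \<and>
     (\<forall>i. distributed M lborel (\<lambda>\<omega>. \<xi> \<omega> $ i) (normal_density 0 \<sigma>))"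

end

theory Submission
  imports Defs
begin

text \<open>
  Both estimators minimise a criterion that contains \<open>lam * KL \<theta> \<pi>\<close>. Comparing the minimiser with
  the point mass at a reference set \<open>K\<close> bounds its loss by the loss of the least squares estimator
  on \<open>K\<close>, the price \<open>- lam * ln (\<pi> K)\<close>, and an average over \<open>\<theta>\<close> of noise terms \<open>h\<^sub>J\<close> minus
  \<open>lam * KL \<theta> \<pi>\<close>. By the Gibbs variational principle (\<open>gibbs_variational\<close>) the latter is at
  most the log-partition function \<open>lam * ln (\<Sum>J. \<pi> J * exp (h\<^sub>J / lam))\<close>, whatever \<open>\<theta>\<close> is. Hence it
  suffices that \<open>E exp (h\<^sub>J / lam) \<le> 1\<close> for every single \<open>J\<close>: Markov's inequality then gives the
  bound with the additional price \<open>lam * ln (1 / \<delta>)\<close> (\<open>log_partition_deviation\<close>).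

  The noise terms have the form \<open>\<langle>w\<^sub>J, \<xi>\<rangle> - c\<^sub>J + 2 \<parallel>A\<^sub>J \<xi>\<parallel>\<^sup>2 - C\<^sub>J\<close>. The penalty
  \<open>C\<^sub>J = 4 \<sigma>\<^sup>2 rank A\<^sub>J\<close> compensates the quadratic part, and the linear part is compensated as soon
  as \<open>\<sigma>\<^sup>2 \<parallel>w\<^sub>J\<parallel>\<^sup>2 \<le> lam * c\<^sub>J\<close> (\<open>iso_normal_exp_penalised\<close>). The two estimators differ in where
  \<open>c\<^sub>J\<close> comes from. For the \<open>Q\<close>-aggregate it is half of \<open>\<parallel>A\<^sub>J \<mu> - A\<^sub>K \<mu>\<parallel>\<^sup>2\<close>, supplied by the
  variance term of the criterion together with its strong convexity (\<open>Q_aggregate_oracle\<close>), so that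
  the leading constant is one. For exponential weights it is a share \<open>8 \<sigma>\<^sup>2 / lam\<close> of the biases
  of \<open>J\<close> and \<open>K\<close>, which has to be taken from the loss itself and increases the leading constant
  (\<open>EW_oracle\<close>).

  Finally, \<open>C\<^sub>K - lam * ln (\<pi> K) + lam * ln (1 / \<delta>)\<close> is at most
  \<open>2 (lam + 2 \<sigma>\<^sup>2) k ln (2 e p / (k \<delta>))\<close> with \<open>k = max 1 (card K)\<close> (\<open>complexity_cost_le\<close>), and
  there are finitely many sets \<open>K\<close>, so the best one can be taken as reference
  (\<open>sparsity_oracle_deviation\<close>).
\<close>

section \<open>Gaussian exponential moments\<close>

lemma nn_integral_normal_exp:
  assumes "0 < \<sigma>"
  shows "(\<integral>\<^sup>+x. ennreal (normal_density 0 \<sigma> x) * ennreal (exp (a * x)) \<partial>lborel)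
    = ennreal (exp (\<sigma>\<^sup>2 * a\<^sup>2 / 2))"
proof -
  have "normal_density 0 \<sigma> x * exp (a * x)
      = exp (\<sigma>\<^sup>2 * a\<^sup>2 / 2) * normal_density (\<sigma>\<^sup>2 * a) \<sigma> x" for x
  proof -
    have "- (x - 0)\<^sup>2 / (2 * \<sigma>\<^sup>2) + a * x = \<sigma>\<^sup>2 * a\<^sup>2 / 2 + - (x - \<sigma>\<^sup>2 * a)\<^sup>2 / (2 * \<sigma>\<^sup>2)"
      using assms by (simp add: field_simps power2_eq_square)
    then have "exp (- (x - 0)\<^sup>2 / (2 * \<sigma>\<^sup>2)) * exp (a * x)
        = exp (\<sigma>\<^sup>2 * a\<^sup>2 / 2) * exp (- (x - \<sigma>\<^sup>2 * a)\<^sup>2 / (2 * \<sigma>\<^sup>2))"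
      by (simp only: exp_add[symmetric])
    then show ?thesis
      unfolding normal_density_def by (simp add: mult.left_commute mult.assoc)
  qed
  then have "(\<integral>\<^sup>+x. ennreal (normal_density 0 \<sigma> x) * ennreal (exp (a * x)) \<partial>lborel)
      = (\<integral>\<^sup>+x. ennreal (exp (\<sigma>\<^sup>2 * a\<^sup>2 / 2)) * ennreal (normal_density (\<sigma>\<^sup>2 * a) \<sigma> x) \<partial>lborel)"
    by (simp add: ennreal_mult'[symmetric])
  also have "\<dots> = ennreal (exp (\<sigma>\<^sup>2 * a\<^sup>2 / 2)) * (\<integral>\<^sup>+x. ennreal (normal_density (\<sigma>\<^sup>2 * a) \<sigma> x) \<partial>lborel)"
    by (rule nn_integral_cmult) simp
  also have "(\<integral>\<^sup>+x. ennreal (normal_density (\<sigma>\<^sup>2 * a) \<sigma> x) \<partial>lborel) = 1"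
    using assms by (subst nn_integral_eq_integral) auto
  finally show ?thesis by simp
qed

lemma nn_integral_normal_exp_square:
  assumes "s < 1 / 2"
  shows "(\<integral>\<^sup>+z. ennreal (std_normal_density z) * ennreal (exp (s * z\<^sup>2)) \<partial>lborel)
    = ennreal (1 / sqrt (1 - 2 * s))"
proof -
  define c where "c = 1 / sqrt (1 - 2 * s)"
  have c: "c > 0" using assms by (simp add: c_def)
  have c2: "1 / c\<^sup>2 = 1 - 2 * s" using assms by (simp add: c_def power_divide)
  have "std_normal_density z * exp (s * z\<^sup>2) = c * normal_density 0 c z" for z
  proof -
    have "- z\<^sup>2 / 2 + s * z\<^sup>2 = - z\<^sup>2 * (1 / c\<^sup>2) / 2"
      unfolding c2 by (simp add: algebra_simps)
    then have *: "exp (- z\<^sup>2 / 2) * exp (s * z\<^sup>2) = exp (- (z - 0)\<^sup>2 / (2 * c\<^sup>2))"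
      by (simp add: exp_add[symmetric] mult.commute)
    have "c * (1 / sqrt (2 * pi * c\<^sup>2)) = 1 / sqrt (2 * pi)"
      using c by (simp add: real_sqrt_mult)
    then show ?thesis
      unfolding std_normal_density_def normal_density_def[of 0 c]
      using * by (metis mult.assoc)
  qed
  then have "(\<integral>\<^sup>+z. ennreal (std_normal_density z) * ennreal (exp (s * z\<^sup>2)) \<partial>lborel)
      = (\<integral>\<^sup>+z. ennreal c * ennreal (normal_density 0 c z) \<partial>lborel)"
    using c by (simp add: ennreal_mult'[symmetric])
  also have "\<dots> = ennreal c * (\<integral>\<^sup>+z. ennreal (normal_density 0 c z) \<partial>lborel)"
    by (rule nn_integral_cmult) simp
  also have "(\<integral>\<^sup>+z. ennreal (normal_density 0 c z) \<partial>lborel) = 1"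
    using c by (subst nn_integral_eq_integral) auto
  finally show ?thesis by (simp add: c_def)
qed

lemma iso_normal_measurable:
  fixes \<xi> :: "'a \<Rightarrow> real^'n"
  assumes "iso_normal M \<sigma> \<xi>"
  shows "\<xi> \<in> borel_measurable M"
proof -
  have [measurable]: "(\<lambda>\<omega>. \<xi> \<omega> $ i) \<in> borel_measurable M" for i
  proof -
    have "distributed M lborel (\<lambda>\<omega>. \<xi> \<omega> $ i) (normal_density 0 \<sigma>)"
      using assms unfolding iso_normal_def by blast
    from distributed_measurable[OF this] show ?thesis by simp
  qed
  have "\<xi> = (\<lambda>\<omega>. \<Sum>i\<in>UNIV. \<xi> \<omega> $ i *\<^sub>R axis i 1)"
    by (auto simp: vec_eq_iff axis_def if_distrib cong: if_cong)
  moreover have "(\<lambda>\<omega>. \<Sum>i\<in>UNIV. \<xi> \<omega> $ i *\<^sub>R (axis i 1 :: real^'n)) \<in> borel_measurable M"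
    by measurable
  ultimately show ?thesis by simp
qed

lemma iso_normal_exp_linear:
  fixes \<xi> :: "'a \<Rightarrow> real^'n"
  assumes "prob_space M" "0 < \<sigma>" and iso: "iso_normal M \<sigma> \<xi>"
  shows "(\<integral>\<^sup>+\<omega>. ennreal (exp (inner w (\<xi> \<omega>))) \<partial>M) = ennreal (exp (\<sigma>\<^sup>2 * (norm w)\<^sup>2 / 2))"
proof -
  interpret prob_space M by fact
  have indep: "indep_vars (\<lambda>_. borel) (\<lambda>i \<omega>. \<xi> \<omega> $ i) UNIV"
    and dist: "\<And>i. distributed M lborel (\<lambda>\<omega>. \<xi> \<omega> $ i) (normal_density 0 \<sigma>)"
    using iso unfolding iso_normal_def by auto
  have "(\<integral>\<^sup>+\<omega>. ennreal (exp (inner w (\<xi> \<omega>))) \<partial>M)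
      = (\<integral>\<^sup>+\<omega>. (\<Prod>i\<in>UNIV. ennreal (exp (w $ i * \<xi> \<omega> $ i))) \<partial>M)"
    by (simp add: inner_vec_def exp_sum prod_ennreal)
  also have "\<dots> = (\<Prod>i\<in>UNIV. \<integral>\<^sup>+\<omega>. ennreal (exp (w $ i * \<xi> \<omega> $ i)) \<partial>M)"
    by (intro indep_vars_nn_integral indep_vars_compose2[OF indep]) auto
  also have "\<dots> = (\<Prod>i\<in>UNIV. ennreal (exp (\<sigma>\<^sup>2 * (w $ i)\<^sup>2 / 2)))"
  proof (rule prod.cong[OF refl])
    fix i
    show "(\<integral>\<^sup>+\<omega>. ennreal (exp (w $ i * \<xi> \<omega> $ i)) \<partial>M) = ennreal (exp (\<sigma>\<^sup>2 * (w $ i)\<^sup>2 / 2))"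
      using distributed_nn_integral[OF dist[of i], of "\<lambda>x. ennreal (exp (w $ i * x))"]
        nn_integral_normal_exp[OF assms(2), of "w $ i"] by simp
  qed
  also have "\<dots> = ennreal (exp (\<sigma>\<^sup>2 * (norm w)\<^sup>2 / 2))"
  proof -
    have "(norm w)\<^sup>2 = (\<Sum>i\<in>UNIV. (w $ i)\<^sup>2)"
      unfolding power2_norm_eq_inner by (simp add: inner_vec_def power2_eq_square)
    then show ?thesis
      by (simp add: prod_ennreal exp_sum[symmetric] sum_divide_distrib sum_distrib_left)
  qed
  finally show ?thesis .
qed

text \<open>
  The square in the exponent is linearised by an auxiliary standard normal variable \<open>z\<close>,
  through \<open>exp (t * a\<^sup>2) = E exp (sqrt (2 * t) * a * z)\<close>. Each vector of the orthonormal set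
  is thereby absorbed into the linear term, which stays orthogonal to the remaining ones.
\<close>
lemma iso_normal_exp_quadratic:
  fixes \<xi> :: "'a \<Rightarrow> real^'n"
  assumes M: "prob_space M" and \<sigma>: "0 < \<sigma>" and iso: "iso_normal M \<sigma> \<xi>"
    and t: "0 \<le> t" "2 * t * \<sigma>\<^sup>2 < 1"
    and B: "finite B" "pairwise orthogonal B" "\<And>u. u \<in> B \<Longrightarrow> norm u = 1"
    and w: "\<And>u. u \<in> B \<Longrightarrow> orthogonal w u"
  shows "(\<integral>\<^sup>+\<omega>. ennreal (exp (inner w (\<xi> \<omega>) + t * (\<Sum>u\<in>B. (inner u (\<xi> \<omega>))\<^sup>2))) \<partial>M)
    = ennreal (exp (\<sigma>\<^sup>2 * (norm w)\<^sup>2 / 2) * (1 / sqrt (1 - 2 * t * \<sigma>\<^sup>2)) ^ card B)"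
  using B w
proof (induction B arbitrary: w rule: finite_induct)
  case empty
  then show ?case using iso_normal_exp_linear[OF M \<sigma> iso] by simp
next
  case (insert u B)
  interpret prob_space M by fact
  interpret P: pair_sigma_finite M lborel ..
  have [measurable]: "\<xi> \<in> borel_measurable M" by (rule iso_normal_measurable[OF iso])
  define q where "q = sqrt (2 * t)"
  have q2: "q\<^sup>2 = 2 * t" using t by (simp add: q_def)
  let ?S = "\<lambda>\<omega>. t * (\<Sum>u\<in>B. (inner u (\<xi> \<omega>))\<^sup>2)"
  let ?c = "1 / sqrt (1 - 2 * t * \<sigma>\<^sup>2)"
  have u: "norm u = 1" using insert.prems by simp
  have wu: "orthogonal w u" and uB: "\<And>v. v \<in> B \<Longrightarrow> orthogonal u v"
    using insert.prems insert.hyps by (auto simp: pairwise_insert)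
  have IH: "(\<integral>\<^sup>+\<omega>. ennreal (exp (inner (w + (q * z) *\<^sub>R u) (\<xi> \<omega>) + ?S \<omega>)) \<partial>M)
      = ennreal (exp (\<sigma>\<^sup>2 * (norm w)\<^sup>2 / 2) * exp (t * \<sigma>\<^sup>2 * z\<^sup>2) * ?c ^ card B)" for z
  proof -
    have "inner w u = 0" using wu by (simp add: orthogonal_def)
    then have "(norm (w + (q * z) *\<^sub>R u))\<^sup>2 = (norm w)\<^sup>2 + (q * z)\<^sup>2"
      using u by (subst norm_add_Pythagorean) (simp_all add: orthogonal_def)
    then have *: "(norm (w + (q * z) *\<^sub>R u))\<^sup>2 = (norm w)\<^sup>2 + 2 * t * z\<^sup>2"
      by (simp add: power_mult_distrib q2)
    have "(\<integral>\<^sup>+\<omega>. ennreal (exp (inner (w + (q * z) *\<^sub>R u) (\<xi> \<omega>) + ?S \<omega>)) \<partial>M)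
      = ennreal (exp (\<sigma>\<^sup>2 * (norm (w + (q * z) *\<^sub>R u))\<^sup>2 / 2) * ?c ^ card B)"
    proof (rule insert.IH)
      show "pairwise orthogonal B" "\<And>u. u \<in> B \<Longrightarrow> norm u = 1"
        using insert.prems by (auto simp: pairwise_insert)
      show "orthogonal (w + (q * z) *\<^sub>R u) v" if "v \<in> B" for v
        using that uB[OF that] insert.prems(3)[of v] by (simp add: orthogonal_def inner_add_left)
    qed
    then show ?thesis unfolding * by (simp add: exp_add[symmetric] algebra_simps add_divide_distrib)
  qed
  have split: "ennreal (exp (inner w (\<xi> \<omega>) + t * (\<Sum>u\<in>insert u B. (inner u (\<xi> \<omega>))\<^sup>2)))
      = (\<integral>\<^sup>+z. ennreal (std_normal_density z)
            * ennreal (exp (inner (w + (q * z) *\<^sub>R u) (\<xi> \<omega>) + ?S \<omega>)) \<partial>lborel)" for \<omega>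
  proof -
    have e: "exp (inner (w + (q * z) *\<^sub>R u) (\<xi> \<omega>) + ?S \<omega>)
        = exp (inner w (\<xi> \<omega>) + ?S \<omega>) * exp ((q * inner u (\<xi> \<omega>)) * z)" for z
      by (simp add: exp_add[symmetric] inner_add_left algebra_simps)
    have "(\<integral>\<^sup>+z. ennreal (std_normal_density z)
            * ennreal (exp (inner (w + (q * z) *\<^sub>R u) (\<xi> \<omega>) + ?S \<omega>)) \<partial>lborel)
      = (\<integral>\<^sup>+z. ennreal (exp (inner w (\<xi> \<omega>) + ?S \<omega>))
            * (ennreal (std_normal_density z) * ennreal (exp ((q * inner u (\<xi> \<omega>)) * z))) \<partial>lborel)"
      unfolding e by (simp add: ennreal_mult' mult.left_commute)
    also have "\<dots> = ennreal (exp (inner w (\<xi> \<omega>) + ?S \<omega>))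
            * (\<integral>\<^sup>+z. ennreal (std_normal_density z) * ennreal (exp ((q * inner u (\<xi> \<omega>)) * z)) \<partial>lborel)"
      by (rule nn_integral_cmult) simp
    also have "\<dots> = ennreal (exp (inner w (\<xi> \<omega>) + ?S \<omega>) * exp (t * (inner u (\<xi> \<omega>))\<^sup>2))"
      using nn_integral_normal_exp[of 1 "q * inner u (\<xi> \<omega>)"]
      by (simp add: power_mult_distrib q2 ennreal_mult')
    finally show ?thesis
      using insert.hyps by (simp add: exp_add[symmetric] algebra_simps)
  qed
  have "(\<integral>\<^sup>+\<omega>. ennreal (exp (inner w (\<xi> \<omega>) + t * (\<Sum>u\<in>insert u B. (inner u (\<xi> \<omega>))\<^sup>2))) \<partial>M)
      = (\<integral>\<^sup>+z. \<integral>\<^sup>+\<omega>. ennreal (std_normal_density z)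
            * ennreal (exp (inner (w + (q * z) *\<^sub>R u) (\<xi> \<omega>) + ?S \<omega>)) \<partial>M \<partial>lborel)"
    unfolding split by (rule P.Fubini'[symmetric]) measurable
  also have "\<dots> = (\<integral>\<^sup>+z. ennreal (std_normal_density z)
            * ennreal (exp (\<sigma>\<^sup>2 * (norm w)\<^sup>2 / 2) * exp (t * \<sigma>\<^sup>2 * z\<^sup>2) * ?c ^ card B) \<partial>lborel)"
    by (intro nn_integral_cong) (subst nn_integral_cmult, measurable, simp only: IH)
  also have "\<dots> = (\<integral>\<^sup>+z. ennreal (exp (\<sigma>\<^sup>2 * (norm w)\<^sup>2 / 2) * ?c ^ card B)
            * (ennreal (std_normal_density z) * ennreal (exp (t * \<sigma>\<^sup>2 * z\<^sup>2))) \<partial>lborel)"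
    using t by (simp add: ennreal_mult'[symmetric] mult_ac)
  also have "\<dots> = ennreal (exp (\<sigma>\<^sup>2 * (norm w)\<^sup>2 / 2) * ?c ^ card B)
            * (\<integral>\<^sup>+z. ennreal (std_normal_density z) * ennreal (exp (t * \<sigma>\<^sup>2 * z\<^sup>2)) \<partial>lborel)"
    by (rule nn_integral_cmult) simp
  also have "\<dots> = ennreal (exp (\<sigma>\<^sup>2 * (norm w)\<^sup>2 / 2) * ?c ^ card B * ?c)"
    using t by (subst nn_integral_normal_exp_square) (simp_all add: ennreal_mult'[symmetric] mult_ac)
  finally show ?case using insert.hyps by (simp add: mult_ac)
qed

section \<open>Least squares projections\<close>

lemma lse_in_span: "lse X y J \<in> span ((\<lambda>j. column j X) ` J)"
  unfolding lse_def by (rule proj_mat_orthogonal_projection)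

lemma inner_residual_span:
  "z \<in> span ((\<lambda>j. column j X) ` J) \<Longrightarrow> inner (y - lse X y J) z = 0"
  unfolding lse_def by (rule proj_mat_orthogonal_projection)

lemma linear_lse: "linear (\<lambda>y. lse X y J)"
  unfolding lse_def by (rule matrix_vector_mul_linear)

lemmas lse_add = linear_add[OF linear_lse]
lemmas lse_diff = linear_diff[OF linear_lse]
lemmas lse_scaleR = linear_scale[OF linear_lse]

lemma continuous_on_lse [continuous_intros]:
  "continuous_on A f \<Longrightarrow> continuous_on A (\<lambda>x. lse X (f x) J)"
  unfolding lse_def by (rule bounded_linear.continuous_on[OF matrix_vector_mul_bounded_linear])

lemma inner_lse_eq: "inner (lse X x J) (lse X y J) = inner (lse X x J) y"
proof -
  have "inner (y - lse X y J) (lse X x J) = 0"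
    by (rule inner_residual_span[OF lse_in_span])
  then show ?thesis
    by (simp add: inner_diff_left inner_commute[of "lse X x J"])
qed

lemma lse_symmetric: "inner (lse X x J) y = inner x (lse X y J)"
  using inner_lse_eq[of X x J y] inner_lse_eq[of X y J x]
  by (simp add: inner_commute[of "lse X y J"])

lemma inner_lse_self: "inner (lse X y J) y = (norm (lse X y J))\<^sup>2"
  unfolding power2_norm_eq_inner by (rule inner_lse_eq[symmetric])

lemma norm_lse_pythagoras: "(norm (y - lse X y J))\<^sup>2 = (norm y)\<^sup>2 - (norm (lse X y J))\<^sup>2"
  unfolding power2_norm_eq_inner
  by (simp add: inner_diff_left inner_diff_right inner_lse_eq inner_commute[of y "lse X y J"])

lemma norm_residual_le: "norm (y - lse X y J) \<le> norm y"
  by (rule power2_le_imp_le) (simp_all add: norm_lse_pythagoras)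

lemma norm_residual_le_span:
  assumes "z \<in> span ((\<lambda>j. column j X) ` J)"
  shows "(norm (y - lse X y J))\<^sup>2 \<le> (norm (y - z))\<^sup>2"
proof -
  let ?r = "y - lse X y J" and ?s = "lse X y J - z"
  have "inner ?r ?s = 0"
    by (intro inner_residual_span span_diff lse_in_span assms)
  then have "(norm (?r + ?s))\<^sup>2 = (norm ?r)\<^sup>2 + (norm ?s)\<^sup>2"
    by (intro norm_add_Pythagorean) (simp add: orthogonal_def)
  then show ?thesis by simp
qed

text \<open>
  A projection \<open>P\<close> gives the isometry \<open>2 P - I\<close>, and \<open>P - Q\<close> is half the difference of two such
  isometries. The constant \<open>1\<close>, rather than the obvious \<open>2\<close>, is what makes the temperature
  \<open>20 \<sigma>\<^sup>2\<close> sufficient for the \<open>Q\<close>-aggregate.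
\<close>
lemma norm_lse_diff_le: "norm (lse X y J - lse X y K) \<le> norm y"
proof -
  have isometry: "norm (2 *\<^sub>R lse X y L - y) = norm y" for L
  proof -
    have "(norm (2 *\<^sub>R lse X y L - y))\<^sup>2 = (norm y)\<^sup>2"
      unfolding power2_norm_eq_inner
      by (simp add: inner_diff_left inner_diff_right inner_lse_eq inner_commute[of y "lse X y L"])
    then show ?thesis by simp
  qed
  have "2 *\<^sub>R (lse X y J - lse X y K) = (2 *\<^sub>R lse X y J - y) - (2 *\<^sub>R lse X y K - y)"
    by (simp add: algebra_simps)
  then have "norm (2 *\<^sub>R (lse X y J - lse X y K)) \<le> norm y + norm y"
    by (metis isometry norm_triangle_ineq4)
  then show ?thesis by simp
qed

text \<open>
  The quadratic noise term and the penalty are expressed through one orthonormal set, the form in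
  which the Gaussian moment is computed.
\<close>
lemma lse_orthonormal_basis:
  fixes X :: "real^'p^'n"
  obtains B where "finite B" "pairwise orthogonal B" "\<forall>u\<in>B. norm u = 1"
    "\<forall>y. (norm (lse X y J))\<^sup>2 = (\<Sum>u\<in>B. (inner u y)\<^sup>2)"
    "trace (proj_mat X J) = real (card B)" "card B \<le> card J"
proof -
  let ?V = "span ((\<lambda>j. column j X) ` J)"
  obtain B where B: "B \<subseteq> ?V" "pairwise orthogonal B" "\<And>x. x \<in> B \<Longrightarrow> norm x = 1"
    "independent B" "card B = dim ?V" "span B = ?V"
    using orthonormal_basis_subspace[OF subspace_span] by metis
  have fin: "finite B" using B(4) independent_imp_finite by blast
  have proj: "lse X y J = (\<Sum>u\<in>B. inner u y *\<^sub>R u)" for y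
  proof -
    let ?s = "\<Sum>u\<in>B. inner u y *\<^sub>R u"
    have "inner (lse X y J - ?s) v = 0" if v: "v \<in> B" for v
    proof -
      have "inner (lse X y J) v = inner y v"
        using inner_residual_span[of v X J y] v B(1) by (auto simp: inner_diff_left)
      moreover have "inner ?s v = (\<Sum>u\<in>B. if u = v then inner v y else 0)"
        unfolding inner_sum_left
      proof (rule sum.cong[OF refl])
        fix u assume "u \<in> B"
        then show "inner (inner u y *\<^sub>R u) v = (if u = v then inner v y else 0)"
          using v B(2) B(3)[OF v] by (auto simp: pairwise_def orthogonal_def dot_square_norm)
      qed
      ultimately show ?thesis using fin v by (simp add: inner_diff_left inner_commute[of y])
    qed
    then have "orthogonal (lse X y J - ?s) z" if "z \<in> span B" for z
      using that by (intro orthogonal_to_span[of z B]) (auto simp: orthogonal_def)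
    moreover have "lse X y J - ?s \<in> span B"
      unfolding B(6)
    proof (rule span_diff[OF lse_in_span])
      show "?s \<in> ?V" using B(1) by (intro span_sum span_scale) auto
    qed
    ultimately have "orthogonal (lse X y J - ?s) (lse X y J - ?s)" by blast
    then show ?thesis by (simp add: orthogonal_self)
  qed
  have norm2: "(norm (lse X y J))\<^sup>2 = (\<Sum>u\<in>B. (inner u y)\<^sup>2)" for y
  proof -
    have "(norm (lse X y J))\<^sup>2 = inner (\<Sum>u\<in>B. inner u y *\<^sub>R u) y"
      unfolding inner_lse_self[symmetric] by (subst (1) proj) (rule refl)
    then show ?thesis by (simp add: inner_sum_left power2_eq_square)
  qed
  have "trace (proj_mat X J) = (\<Sum>i\<in>UNIV. (norm (lse X (axis i 1) J))\<^sup>2)"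
    unfolding trace_def
  proof (rule sum.cong[OF refl])
    fix i :: 'n
    have "proj_mat X J $ i $ i = inner (lse X (axis i 1) J) (axis i 1)"
      by (simp add: lse_def matrix_vector_mult_basis column_def inner_axis)
    then show "proj_mat X J $ i $ i = (norm (lse X (axis i 1) J))\<^sup>2"
      by (simp add: inner_lse_self)
  qed
  also have "\<dots> = (\<Sum>u\<in>B. \<Sum>i\<in>UNIV. (inner u (axis i 1))\<^sup>2)"
    unfolding norm2 by (rule sum.swap)
  also have "\<dots> = (\<Sum>u\<in>B. (norm u)\<^sup>2)"
    unfolding power2_norm_eq_inner inner_axis
    by (simp add: inner_vec_def power2_eq_square)
  also have "\<dots> = real (card B)" using B(3) by simp
  finally have tr: "trace (proj_mat X J) = real (card B)" .
  have "card B \<le> card ((\<lambda>j. column j X) ` J)"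
    unfolding B(5) dim_span by (rule dim_le_card') simp
  also have "\<dots> \<le> card J" by (rule card_image_le) simp
  finally have "card B \<le> card J" .
  then show thesis using that[of B] fin B(2,3) norm2 tr by blast
qed

lemma lse_pen_le:
  fixes X :: "real^'p^'n"
  shows "lse_pen \<sigma> X J \<le> 4 * \<sigma>\<^sup>2 * real (card J)"
proof -
  obtain B :: "(real^'n) set" where "trace (proj_mat X J) = real (card B)" "card B \<le> card J"
    by (rule lse_orthonormal_basis[of X J])
  then show ?thesis
    unfolding lse_pen_def by (auto intro: mult_left_mono)
qed

lemma inverse_sqrt_le_exp:
  fixes x :: real
  assumes "0 \<le> x" "x \<le> 1 / 2"
  shows "1 / sqrt (1 - x) \<le> exp x"
proof -
  have "1 \<le> (1 - x) * (1 + 2 * x)"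
  proof -
    have "0 \<le> x * (1 - 2 * x)" using assms by (intro mult_nonneg_nonneg) auto
    then show ?thesis by (simp add: algebra_simps)
  qed
  also have "\<dots> \<le> (1 - x) * (exp x)\<^sup>2"
    using assms exp_ge_add_one_self[of "2 * x"]
    by (intro mult_left_mono) (auto simp: exp_double[symmetric])
  finally have "1 \<le> sqrt ((1 - x) * (exp x)\<^sup>2)" by simp
  then show ?thesis
    using assms by (simp add: real_sqrt_mult divide_simps mult.commute)
qed

text \<open>
  The penalty \<open>4 \<sigma>\<^sup>2 rank\<close> is twice the mean of the quadratic term; the excess pays for the
  exponential moment. The quadratic and the linear part are separated by
  \<open>exp (a + b) \<le> (exp (2 a) + exp (2 b)) / 2\<close>, so that only their separate moments
  enter.
\<close>
lemma iso_normal_exp_penalised: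
  fixes \<xi> :: "'a \<Rightarrow> real^'n" and X :: "real^'p^'n"
  assumes M: "prob_space M" and \<sigma>: "0 < \<sigma>" and iso: "iso_normal M \<sigma> \<xi>"
    and lam: "16 * \<sigma>\<^sup>2 \<le> lam" and c: "\<sigma>\<^sup>2 * (norm w)\<^sup>2 \<le> lam * c"
  shows "(\<integral>\<^sup>+\<omega>. ennreal (exp ((inner w (\<xi> \<omega>) - c
            + (2 * (norm (lse X (\<xi> \<omega>) J))\<^sup>2 - lse_pen \<sigma> X J)) / lam)) \<partial>M) \<le> 1"
proof -
  interpret prob_space M by fact
  have [measurable]: "\<xi> \<in> borel_measurable M" by (rule iso_normal_measurable[OF iso])
  have lam0: "lam > 0" using lam \<sigma> by (smt (verit) zero_less_power)
  obtain B where B: "finite B" "pairwise orthogonal B" "\<forall>u\<in>B. norm u = 1"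
    and norm2: "\<forall>y. (norm (lse X y J))\<^sup>2 = (\<Sum>u\<in>B. (inner u y)\<^sup>2)"
    and tr: "trace (proj_mat X J) = real (card B)" and "card B \<le> card J"
    by (rule lse_orthonormal_basis[of X J])
  note n2 = norm2[rule_format]
  define a where "a \<omega> = (inner w (\<xi> \<omega>) - c) / lam" for \<omega>
  define b where "b \<omega> = (2 * (norm (lse X (\<xi> \<omega>) J))\<^sup>2 - lse_pen \<sigma> X J) / lam" for \<omega>
  have meas [measurable]: "(\<lambda>\<omega>. a \<omega>) \<in> borel_measurable M" "(\<lambda>\<omega>. b \<omega>) \<in> borel_measurable M"
    unfolding a_def b_def n2 by measurable
  have "(\<integral>\<^sup>+\<omega>. ennreal (exp (2 * a \<omega>)) \<partial>M) \<le> 1"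
  proof -
    have "2 * a \<omega> = - (2 * c / lam) + inner ((2 / lam) *\<^sub>R w) (\<xi> \<omega>)" for \<omega>
      by (simp add: a_def diff_divide_distrib algebra_simps)
    then have "(\<integral>\<^sup>+\<omega>. ennreal (exp (2 * a \<omega>)) \<partial>M)
        = (\<integral>\<^sup>+\<omega>. ennreal (exp (- (2 * c / lam))) * ennreal (exp (inner ((2 / lam) *\<^sub>R w) (\<xi> \<omega>))) \<partial>M)"
      by (simp only: exp_add ennreal_mult' exp_ge_zero)
    also have "\<dots> = ennreal (exp (- (2 * c / lam)))
        * (\<integral>\<^sup>+\<omega>. ennreal (exp (inner ((2 / lam) *\<^sub>R w) (\<xi> \<omega>))) \<partial>M)"
      by (rule nn_integral_cmult) measurable
    also have "\<dots> = ennreal (exp (- (2 * c / lam)) * exp (\<sigma>\<^sup>2 * (norm ((2 / lam) *\<^sub>R w))\<^sup>2 / 2))"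
      unfolding iso_normal_exp_linear[OF M \<sigma> iso] by (simp add: ennreal_mult')
    also have "\<dots> = ennreal (exp (2 / lam\<^sup>2 * (\<sigma>\<^sup>2 * (norm w)\<^sup>2 - lam * c)))"
    proof -
      have "- (2 * c / lam) + \<sigma>\<^sup>2 * (norm ((2 / lam) *\<^sub>R w))\<^sup>2 / 2
          = 2 / lam\<^sup>2 * (\<sigma>\<^sup>2 * (norm w)\<^sup>2 - lam * c)"
        using lam0 by (simp add: field_simps power2_eq_square)
      then show ?thesis by (simp only: exp_add[symmetric])
    qed
    also have "\<dots> \<le> ennreal 1"
    proof (rule ennreal_leI)
      have "2 / lam\<^sup>2 * (\<sigma>\<^sup>2 * (norm w)\<^sup>2 - lam * c) \<le> 0"
        using c by (intro mult_nonneg_nonpos) auto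
      then show "exp (2 / lam\<^sup>2 * (\<sigma>\<^sup>2 * (norm w)\<^sup>2 - lam * c)) \<le> 1" by simp
    qed
    finally show ?thesis by simp
  qed
  moreover have "(\<integral>\<^sup>+\<omega>. ennreal (exp (2 * b \<omega>)) \<partial>M) \<le> 1"
  proof -
    define x where "x = 8 * \<sigma>\<^sup>2 / lam"
    have x: "0 \<le> x" "x \<le> 1 / 2" using lam lam0 by (auto simp: x_def field_simps)
    have "2 * b \<omega> = - (x * card B)
        + (inner 0 (\<xi> \<omega>) + 4 / lam * (\<Sum>u\<in>B. (inner u (\<xi> \<omega>))\<^sup>2))" for \<omega>
      by (simp add: b_def x_def n2 lse_pen_def tr diff_divide_distrib algebra_simps)
    then have "(\<integral>\<^sup>+\<omega>. ennreal (exp (2 * b \<omega>)) \<partial>M)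
        = (\<integral>\<^sup>+\<omega>. ennreal (exp (- (x * card B)))
            * ennreal (exp (inner 0 (\<xi> \<omega>) + 4 / lam * (\<Sum>u\<in>B. (inner u (\<xi> \<omega>))\<^sup>2))) \<partial>M)"
      by (simp only: exp_add[of "- (x * card B)"] ennreal_mult' exp_ge_zero)
    also have "\<dots> = ennreal (exp (- (x * card B)))
        * (\<integral>\<^sup>+\<omega>. ennreal (exp (inner 0 (\<xi> \<omega>) + 4 / lam * (\<Sum>u\<in>B. (inner u (\<xi> \<omega>))\<^sup>2))) \<partial>M)"
      by (rule nn_integral_cmult) measurable
    also have "\<dots> = ennreal (exp (- (x * card B)) * (1 / sqrt (1 - x)) ^ card B)"
    proof -
      have "(\<integral>\<^sup>+\<omega>. ennreal (exp (inner 0 (\<xi> \<omega>) + 4 / lam * (\<Sum>u\<in>B. (inner u (\<xi> \<omega>))\<^sup>2))) \<partial>M)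
        = ennreal (exp (\<sigma>\<^sup>2 * (norm (0::real^'n))\<^sup>2 / 2)
            * (1 / sqrt (1 - 2 * (4 / lam) * \<sigma>\<^sup>2)) ^ card B)"
        using lam0 x B
        by (intro iso_normal_exp_quadratic[OF M \<sigma> iso]) (auto simp: x_def orthogonal_def)
      then show ?thesis by (simp add: x_def ennreal_mult')
    qed
    also have "\<dots> \<le> ennreal (exp (- (x * card B)) * exp x ^ card B)"
      using x by (intro ennreal_leI mult_left_mono power_mono inverse_sqrt_le_exp) auto
    also have "\<dots> = 1" by (simp add: exp_of_nat_mult[symmetric] exp_add[symmetric] mult.commute)
    finally show ?thesis .
  qed
  moreover define h :: real where "h = 1 / 2"
  have h: "0 \<le> h" "h + h = 1" by (simp_all add: h_def)
  have "exp (a \<omega> + b \<omega>) \<le> h * exp (2 * a \<omega>) + h * exp (2 * b \<omega>)" for \<omega>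
    using sum_squares_bound[of "exp (a \<omega>)" "exp (b \<omega>)"] by (simp add: exp_add exp_double h_def)
  then have "ennreal (exp (a \<omega> + b \<omega>))
      \<le> ennreal h * ennreal (exp (2 * a \<omega>)) + ennreal h * ennreal (exp (2 * b \<omega>))" for \<omega>
    using h by (simp add: ennreal_mult'[symmetric] ennreal_plus[symmetric] ennreal_leI del: ennreal_plus)
  then have "(\<integral>\<^sup>+\<omega>. ennreal (exp (a \<omega> + b \<omega>)) \<partial>M)
      \<le> (\<integral>\<^sup>+\<omega>. ennreal h * ennreal (exp (2 * a \<omega>)) + ennreal h * ennreal (exp (2 * b \<omega>)) \<partial>M)"
    by (rule nn_integral_mono)
  then have "(\<integral>\<^sup>+\<omega>. ennreal (exp (a \<omega> + b \<omega>)) \<partial>M)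
      \<le> ennreal h * (\<integral>\<^sup>+\<omega>. ennreal (exp (2 * a \<omega>)) \<partial>M)
        + ennreal h * (\<integral>\<^sup>+\<omega>. ennreal (exp (2 * b \<omega>)) \<partial>M)"
    by (simp add: nn_integral_add nn_integral_cmult)
  ultimately have "(\<integral>\<^sup>+\<omega>. ennreal (exp (a \<omega> + b \<omega>)) \<partial>M) \<le> ennreal h * 1 + ennreal h * 1"
    by (meson add_mono mult_left_mono order_trans zero_le)
  also have "\<dots> = 1" using h by (simp add: ennreal_plus[symmetric] del: ennreal_plus)
  finally show ?thesis by (simp add: a_def b_def add_divide_distrib)
qed


section \<open>The sparsity prior\<close>

lemma sum_over_sets_by_card:
  fixes f :: "nat \<Rightarrow> real"
  shows "(\<Sum>K\<in>(UNIV :: 'p::finite set set). f (card K) / real (CARD('p) choose card K))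
    = (\<Sum>k\<le>CARD('p). f k)"
proof -
  let ?h = "\<lambda>K :: 'p set. f (card K) / real (CARD('p) choose card K)"
  have "(\<Sum>K\<in>UNIV. ?h K) = (\<Sum>k\<le>CARD('p). \<Sum>K\<in>{K\<in>UNIV. card K = k}. ?h K)"
    by (rule sum.group[symmetric]) (auto simp: card_mono)
  also have "\<dots> = (\<Sum>k\<le>CARD('p). f k)"
  proof (rule sum.cong[OF refl])
    fix k assume "k \<in> {..CARD('p)}"
    then have "CARD('p) choose k > 0" by (simp add: zero_less_binomial)
    moreover have "card {K :: 'p set. card K = k} = CARD('p) choose k"
      using n_subsets[of "UNIV :: 'p set" k] by simp
    ultimately show "(\<Sum>K\<in>{K\<in>UNIV. card K = k}. ?h K) = f k" by simp
  qed
  finally show ?thesis .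
qed

definition prior_mass :: "'p::finite itself \<Rightarrow> real" where
  "prior_mass _ = (\<Sum>K\<in>UNIV. exp (- real (card (K :: 'p set))) / real (CARD('p) choose card K))"

lemma prior_mass_bounds: "0 < prior_mass TYPE('p::finite)" "prior_mass TYPE('p) \<le> 2"
proof -
  have *: "prior_mass TYPE('p) = (\<Sum>k\<le>CARD('p). exp (- 1) ^ k)"
    unfolding prior_mass_def sum_over_sets_by_card[of "\<lambda>k. exp (- real k)"]
    by (simp add: exp_of_nat_mult[symmetric])
  then show "0 < prior_mass TYPE('p)" by (simp add: sum_pos)
  have "exp (- 1) \<le> (1 / 2 :: real)"
    using exp_ge_add_one_self[of 1] by (simp add: exp_minus field_simps)
  then have "prior_mass TYPE('p) \<le> (\<Sum>k\<le>CARD('p). (1 / 2) ^ k)"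
    unfolding * by (intro sum_mono power_mono) auto
  also have "(\<Sum>k\<le>n. (1 / 2 :: real) ^ k) = 2 - (1 / 2) ^ n" for n
    by (induction n) (auto simp: field_simps)
  finally show "prior_mass TYPE('p) \<le> 2"
    by (smt (verit) zero_le_power divide_nonneg_nonneg)
qed

lemma sparsity_prior_eq:
  fixes J :: "'p::finite set"
  shows "sparsity_prior J
    = exp (- real (card J)) / real (CARD('p) choose card J) / prior_mass TYPE('p)"
  by (simp add: sparsity_prior_def prior_mass_def)

lemma sparsity_prior_pos: "0 < sparsity_prior (J :: 'p::finite set)"
proof -
  have "CARD('p) choose card J > 0" by (simp add: card_mono)
  then show ?thesis unfolding sparsity_prior_eq using prior_mass_bounds(1)[where 'p = 'p] by simp
qed

lemma sum_sparsity_prior: "(\<Sum>J\<in>UNIV. sparsity_prior (J :: 'p::finite set)) = 1"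
  unfolding sparsity_prior_eq sum_divide_distrib[symmetric]
  using prior_mass_bounds(1)[where 'p = 'p] by (simp add: prior_mass_def[where 'p = 'p])

lemma power_self_le_exp_fact: "real k ^ k \<le> exp (real k) * fact k"
proof -
  have "(\<lambda>n. real k ^ n /\<^sub>R fact n) sums exp (real k)" by (rule exp_converges)
  then have "(\<Sum>n\<in>{k}. real k ^ n /\<^sub>R fact n) \<le> exp (real k)"
    using sum_le_suminf[of "\<lambda>n. real k ^ n /\<^sub>R fact n" "{k}"] by (simp add: sums_iff)
  then show ?thesis by (simp add: field_simps)
qed

lemma ln_binomial_le:
  assumes "1 \<le> k" "k \<le> n"
  shows "ln (real (n choose k)) \<le> real k * ln (exp 1 * real n / real k)"
proof -
  have "real (n choose k) * fact k \<le> real n ^ k"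
    using binomial_fact_pow[of n k] by (metis of_nat_fact of_nat_le_iff of_nat_mult of_nat_power)
  then have "exp (real k) * (real (n choose k) * fact k) \<le> exp (real k) * real n ^ k"
    by (rule mult_left_mono) simp
  moreover have "real (n choose k) * real k ^ k \<le> exp (real k) * (real (n choose k) * fact k)"
    using mult_left_mono[OF power_self_le_exp_fact[of k], of "real (n choose k)"]
    by (simp add: mult.left_commute)
  ultimately have "real (n choose k) * real k ^ k \<le> exp (real k) * real n ^ k"
    by linarith
  also have "exp (real k) = exp 1 ^ k" by (simp add: exp_of_nat_mult[symmetric])
  finally have "real (n choose k) \<le> (exp 1 * real n / real k) ^ k"
    using assms by (simp add: field_simps)
  then have "ln (real (n choose k)) \<le> ln ((exp 1 * real n / real k) ^ k)"
    using assms by (intro ln_mono) auto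
  then show ?thesis using assms by (simp add: ln_realpow)
qed

text \<open>
  The normalisation of the prior costs at most \<open>ln 2\<close>, which is the factor \<open>2\<close> inside the
  logarithm of the bound; \<open>max 1 (card J)\<close> is the sparsity of a vector with support \<open>J\<close>.
\<close>
lemma complexity_cost_le:
  fixes X :: "real^'p^'n" and J :: "'p set"
  defines "k \<equiv> real (max 1 (card J))"
  assumes \<delta>: "0 < \<delta>" "\<delta> < 1" and lam: "0 \<le> lam"
  shows "lse_pen \<sigma> X J - lam * ln (sparsity_prior J) + lam * ln (1 / \<delta>)
      \<le> 2 * (lam + 2 * \<sigma>\<^sup>2) * (k * ln (2 * exp 1 * real CARD('p) / (k * \<delta>)))"
    and "1 \<le> ln (2 * exp 1 * real CARD('p) / (k * \<delta>))"
proof -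
  let ?p = "real CARD('p)"
  define L where "L = ln (2 * exp 1 * ?p / (k * \<delta>))"
  define l where "l = ln (exp 1 * ?p / k)"
  have cJ: "card J \<le> CARD('p)" by (simp add: card_mono)
  have p1: "1 \<le> CARD('p)" by (simp add: Suc_le_eq)
  have k: "1 \<le> k" "k \<le> ?p" using cJ p1 by (auto simp: k_def)
  have "L = ln (2 * (exp 1 * ?p / k) * (1 / \<delta>))" by (simp add: L_def mult.assoc)
  also have "\<dots> = ln 2 + l + ln (1 / \<delta>)"
    unfolding l_def using k \<delta> p1 by (subst ln_mult; (subst ln_mult)?) auto
  finally have L: "L = ln 2 + l + ln (1 / \<delta>)" .
  have "exp 1 \<le> exp 1 * ?p / k" using k by (simp add: field_simps)
  then have "ln (exp 1) \<le> l" unfolding l_def by (intro ln_mono) auto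
  then have l1: "1 \<le> l" by simp
  have ln2: "0 \<le> ln (2::real)" and ld: "0 \<le> ln (1 / \<delta>)" using \<delta> by auto
  then have L1: "1 \<le> L" using L l1 by linarith
  then show "1 \<le> ln (2 * exp 1 * ?p / (k * \<delta>))" by (simp add: L_def)
  define c where "c = real (CARD('p) choose card J)"
  have c: "c > 0" using cJ by (simp add: c_def)
  have prior: "- ln (sparsity_prior J) = real (card J) + ln c + ln (prior_mass TYPE('p))"
    unfolding sparsity_prior_eq c_def[symmetric] using c prior_mass_bounds(1)[where 'p = 'p]
    by (simp add: ln_div ln_mult)
  have Z: "ln (prior_mass TYPE('p)) \<le> ln 2"
    using prior_mass_bounds[where 'p = 'p] by (intro ln_mono) auto
  have bin: "ln c \<le> k * l"
  proof (cases "card J = 0")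
    case True
    then show ?thesis using k l1 by (simp add: c_def)
  next
    case False
    then have "k = real (card J)" unfolding k_def by linarith
    then show ?thesis
      unfolding l_def c_def using ln_binomial_le[of "card J" "CARD('p)"] False cJ by simp
  qed
  have cardk: "real (card J) \<le> k" by (simp add: k_def)
  have kL: "k \<le> k * L" using k L1 by simp
  have "ln 2 + ln (1 / \<delta>) \<le> k * (ln 2 + ln (1 / \<delta>))"
    using mult_right_mono[OF k(1), of "ln 2 + ln (1 / \<delta>)", OF add_nonneg_nonneg[OF ln2 ld]] by simp
  then have "- ln (sparsity_prior J) + ln (1 / \<delta>) \<le> k + k * L"
    unfolding prior L using cardk bin Z by (simp add: algebra_simps)
  also have "\<dots> \<le> 2 * (k * L)" using kL by linarith
  finally have "lam * (- ln (sparsity_prior J) + ln (1 / \<delta>)) \<le> lam * (2 * (k * L))"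
    using lam by (rule mult_left_mono)
  moreover have "lse_pen \<sigma> X J \<le> 4 * \<sigma>\<^sup>2 * (k * L)"
  proof -
    have "4 * \<sigma>\<^sup>2 * real (card J) \<le> 4 * \<sigma>\<^sup>2 * (k * L)"
      using cardk kL by (intro mult_left_mono) auto
    then show ?thesis using lse_pen_le[of \<sigma> X J] by linarith
  qed
  ultimately show "lse_pen \<sigma> X J - lam * ln (sparsity_prior J) + lam * ln (1 / \<delta>)
      \<le> 2 * (lam + 2 * \<sigma>\<^sup>2) * (k * ln (2 * exp 1 * ?p / (k * \<delta>)))"
    unfolding L_def[symmetric] by (simp add: algebra_simps)
qed

section \<open>Entropy and the Gibbs variational principle\<close>

lemma prob_vectorsD:
  assumes "\<theta> \<in> prob_vectors"
  shows "0 \<le> \<theta> J" and "(\<Sum>J\<in>UNIV. \<theta> J) = 1"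
  using assms by (auto simp: prob_vectors_def)

lemma gibbs_variational:
  fixes \<theta> :: "'p::finite set \<Rightarrow> real"
  assumes \<theta>: "\<theta> \<in> prob_vectors" and \<pi>: "\<And>J. 0 < \<pi> J" and lam: "0 < lam"
  shows "(\<Sum>J\<in>UNIV. \<theta> J * h J) - lam * KL \<theta> \<pi>
    \<le> lam * ln (\<Sum>J\<in>UNIV. \<pi> J * exp (h J / lam))"
proof -
  define S where "S = (\<Sum>J\<in>UNIV. \<pi> J * exp (h J / lam))"
  have S: "S > 0" unfolding S_def using \<pi> by (intro sum_pos) auto
  have "\<theta> J * (h J / lam) - \<theta> J * ln (\<theta> J / \<pi> J)
      \<le> \<pi> J * exp (h J / lam) / S - \<theta> J + \<theta> J * ln S" for J
  proof (cases "\<theta> J = 0")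
    case True
    then show ?thesis using \<pi>[of J] S by simp
  next
    case False
    then have pos: "\<theta> J > 0" using prob_vectorsD(1)[OF \<theta>, of J] by simp
    \<comment> \<open>The density of the Gibbs weights with respect to \<open>\<theta>\<close>; the inequality \<open>ln r \<le> r - 1\<close> loses
      nothing exactly when \<open>\<theta>\<close> is the Gibbs vector.\<close>
    define r where "r = \<pi> J * exp (h J / lam) / (\<theta> J * S)"
    have r: "r > 0" unfolding r_def using \<pi> pos S by simp
    have "ln r = ln (\<pi> J) + h J / lam - ln (\<theta> J) - ln S"
      unfolding r_def using \<pi>[of J] pos S by (simp add: ln_div ln_mult)
    then have "h J / lam - ln (\<theta> J / \<pi> J) = ln r + ln S"
      using \<pi>[of J] pos by (simp add: ln_div)
    also have "\<dots> \<le> r - 1 + ln S" using ln_le_minus_one[OF r] by simp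
    finally have "\<theta> J * (h J / lam - ln (\<theta> J / \<pi> J)) \<le> \<theta> J * (r - 1 + ln S)"
      using pos by (intro mult_left_mono) auto
    also have "\<theta> J * r = \<pi> J * exp (h J / lam) / S" unfolding r_def using pos by simp
    then have "\<theta> J * (r - 1 + ln S) = \<pi> J * exp (h J / lam) / S - \<theta> J + \<theta> J * ln S"
      by (simp add: algebra_simps)
    finally show ?thesis by (simp add: algebra_simps)
  qed
  then have "(\<Sum>J\<in>UNIV. \<theta> J * (h J / lam) - \<theta> J * ln (\<theta> J / \<pi> J))
      \<le> (\<Sum>J\<in>UNIV. \<pi> J * exp (h J / lam) / S - \<theta> J + \<theta> J * ln S)"
    by (rule sum_mono)
  also have "\<dots> = ln S"
    using S prob_vectorsD(2)[OF \<theta>]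
    by (simp add: sum.distrib sum_subtractf sum_divide_distrib[symmetric] S_def[symmetric]
        sum_distrib_right[symmetric])
  finally have "(\<Sum>J\<in>UNIV. \<theta> J * h J) / lam - KL \<theta> \<pi> \<le> ln S"
    by (simp add: sum_subtractf KL_def sum_divide_distrib)
  then have "lam * ((\<Sum>J\<in>UNIV. \<theta> J * h J) / lam - KL \<theta> \<pi>) \<le> lam * ln S"
    using lam by (intro mult_left_mono) auto
  then show ?thesis using lam by (simp add: S_def right_diff_distrib)
qed

text \<open>
  Taking for \<open>m\<close> a mixture of two values of \<open>x\<close> yields convexity of the entropy on the closed
  half-line, including the point \<open>x = 0\<close> where it has no derivative.
\<close>
lemma entropy_tangent_le:
  fixes x m c :: real
  assumes "0 \<le> x" "0 < m" "0 < c"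
  shows "x * ln (m / c) + x - m \<le> x * ln (x / c)"
proof (cases "x = 0")
  case False
  then have x: "x > 0" using assms by simp
  have "ln (m / x) \<le> m / x - 1" using x assms by (intro ln_le_minus_one) auto
  then have "x * ln (m / x) \<le> m - x" using x by (simp add: field_simps)
  then show ?thesis using x assms by (simp add: ln_div algebra_simps)
qed (use assms in auto)

lemma KL_convex:
  fixes \<theta> \<eta> :: "'p::finite set \<Rightarrow> real"
  assumes nonneg: "\<And>J. 0 \<le> \<theta> J" "\<And>J. 0 \<le> \<eta> J" and \<pi>: "\<And>J. 0 < \<pi> J"
    and t: "0 < t" "t < 1"
  shows "KL (\<lambda>J. (1 - t) * \<theta> J + t * \<eta> J) \<pi> \<le> (1 - t) * KL \<theta> \<pi> + t * KL \<eta> \<pi>"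
proof -
  have "m * ln (m / \<pi> J) \<le> (1 - t) * (\<theta> J * ln (\<theta> J / \<pi> J)) + t * (\<eta> J * ln (\<eta> J / \<pi> J))"
    if m: "m = (1 - t) * \<theta> J + t * \<eta> J" for m J
  proof (cases "m = 0")
    case True
    moreover have "0 \<le> (1 - t) * \<theta> J" "0 \<le> t * \<eta> J" using nonneg t by auto
    ultimately have "(1 - t) * \<theta> J = 0" "t * \<eta> J = 0" using m by linarith+
    then show ?thesis using True t by auto
  next
    case False
    then have "m > 0" using nonneg[of J] t m by (simp add: less_le)
    then have
      "(1 - t) * (\<theta> J * ln (m / \<pi> J) + \<theta> J - m) \<le> (1 - t) * (\<theta> J * ln (\<theta> J / \<pi> J))"
      "t * (\<eta> J * ln (m / \<pi> J) + \<eta> J - m) \<le> t * (\<eta> J * ln (\<eta> J / \<pi> J))"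
      using nonneg \<pi> t by (auto intro!: mult_left_mono entropy_tangent_le)
    moreover have "(1 - t) * (\<theta> J * ln (m / \<pi> J) + \<theta> J - m) + t * (\<eta> J * ln (m / \<pi> J) + \<eta> J - m)
        = m * ln (m / \<pi> J)"
      unfolding m by (simp add: algebra_simps)
    ultimately show ?thesis by linarith
  qed
  then show ?thesis
    unfolding KL_def sum_distrib_left sum.distrib[symmetric] by (intro sum_mono) simp
qed


section \<open>Strong convexity of the criterion and stability of the \<open>Q\<close>-aggregate\<close>

lemma aggregate_convex_comb:
  "aggregate X y (\<lambda>J. (1 - t) * \<theta> J + t * \<eta> J)
    = (1 - t) *\<^sub>R aggregate X y \<theta> + t *\<^sub>R aggregate X y \<eta>"
  by (simp add: aggregate_def scaleR_add_left sum.distrib scaleR_sum_right)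

lemma norm_convex_comb:
  fixes a b y :: "'b::real_inner"
  shows "(norm (y - ((1 - t) *\<^sub>R a + t *\<^sub>R b)))\<^sup>2
    = (1 - t) * (norm (y - a))\<^sup>2 + t * (norm (y - b))\<^sup>2 - t * (1 - t) * (norm (a - b))\<^sup>2"
proof -
  define u v where "u = y - a" and "v = y - b"
  have 1: "y - ((1 - t) *\<^sub>R a + t *\<^sub>R b) = (1 - t) *\<^sub>R u + t *\<^sub>R v" and 2: "a - b = v - u"
    unfolding u_def v_def by (simp_all add: algebra_simps)
  show ?thesis
    unfolding 1 2 u_def[symmetric] v_def[symmetric] power2_norm_eq_inner
    by (simp add: inner_add_left inner_add_right inner_diff_left inner_diff_right
        inner_commute[of v u] algebra_simps)
qed

lemma bias_variance:
  fixes f :: "'i::finite \<Rightarrow> 'b::real_inner"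
  assumes "(\<Sum>i\<in>UNIV. \<theta> i) = 1" and a: "a = (\<Sum>i\<in>UNIV. \<theta> i *\<^sub>R f i)"
  shows "(\<Sum>i\<in>UNIV. \<theta> i * (norm (f i - c))\<^sup>2)
    = (\<Sum>i\<in>UNIV. \<theta> i * (norm (f i - a))\<^sup>2) + (norm (a - c))\<^sup>2"
proof -
  have "\<theta> i * (norm (f i - c))\<^sup>2 = \<theta> i * (norm (f i - a))\<^sup>2
      + 2 * inner (a - c) (\<theta> i *\<^sub>R f i - \<theta> i *\<^sub>R a) + \<theta> i * (norm (a - c))\<^sup>2" for i
  proof -
    have "(norm (f i - c))\<^sup>2 = (norm (f i - a))\<^sup>2 + 2 * inner (a - c) (f i - a) + (norm (a - c))\<^sup>2"
      using dot_norm[of "f i - a" "a - c"] by (simp add: inner_commute)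
    then show ?thesis
      unfolding scaleR_diff_right[symmetric] inner_scaleR_right by (simp add: distrib_left)
  qed
  then have "(\<Sum>i\<in>UNIV. \<theta> i * (norm (f i - c))\<^sup>2)
      = (\<Sum>i\<in>UNIV. \<theta> i * (norm (f i - a))\<^sup>2 + 2 * inner (a - c) (\<theta> i *\<^sub>R f i - \<theta> i *\<^sub>R a)
          + \<theta> i * (norm (a - c))\<^sup>2)"
    by simp
  also have "\<dots> = (\<Sum>i\<in>UNIV. \<theta> i * (norm (f i - a))\<^sup>2)
      + 2 * inner (a - c) ((\<Sum>i\<in>UNIV. \<theta> i *\<^sub>R f i) - (\<Sum>i\<in>UNIV. \<theta> i) *\<^sub>R a)
      + (\<Sum>i\<in>UNIV. \<theta> i) * (norm (a - c))\<^sup>2"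
    by (simp add: sum.distrib sum_distrib_left[symmetric] inner_sum_right[symmetric]
        sum_subtractf scaleR_sum_left sum_distrib_right)
  finally show ?thesis using assms by simp
qed

text \<open>
  Along the segment from the minimiser to \<open>\<eta>\<close>, every part of the criterion is convex and
  \<open>(1 - \<nu>) \<parallel>y - \<mu>\<^sub>\<theta>\<parallel>\<^sup>2\<close> is strongly convex in \<open>\<mu>\<^sub>\<theta>\<close>. Besides the oracle inequality, for
  \<open>\<nu> < 1\<close> this gap yields that \<open>\<mu>\<^sub>\<theta>\<close> is the same for all minimisers and continuous in \<open>y\<close>.
\<close>
lemma Q_weights_gap:
  assumes \<theta>: "\<theta> \<in> Q_weights \<nu> lam \<sigma> X y" and \<eta>: "\<eta> \<in> prob_vectors"
    and lam: "0 \<le> lam" and \<nu>: "\<nu> \<le> 1"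
  shows "Q_crit \<nu> lam \<sigma> X y \<theta> + (1 - \<nu>) * (norm (aggregate X y \<eta> - aggregate X y \<theta>))\<^sup>2
    \<le> Q_crit \<nu> lam \<sigma> X y \<eta>"
proof -
  let ?Q = "Q_crit \<nu> lam \<sigma> X y"
  let ?d = "(1 - \<nu>) * (norm (aggregate X y \<theta> - aggregate X y \<eta>))\<^sup>2"
  have \<theta>P: "\<theta> \<in> prob_vectors" and min: "\<And>\<zeta>. \<zeta> \<in> prob_vectors \<Longrightarrow> ?Q \<theta> \<le> ?Q \<zeta>"
    using \<theta> by (auto simp: Q_weights_def is_arg_min_linorder)
  have "s * ?d \<le> ?Q \<eta> - ?Q \<theta>" if s: "0 < s" "s < 1" for s :: real
  proof -
    define t where "t = 1 - s"
    have t: "0 < t" "t < 1" using s by (auto simp: t_def)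
    let ?\<zeta> = "\<lambda>J. (1 - t) * \<theta> J + t * \<eta> J"
    have "?\<zeta> \<in> prob_vectors"
      using prob_vectorsD[OF \<theta>P] prob_vectorsD[OF \<eta>] t
      by (auto simp: prob_vectors_def sum.distrib sum_distrib_left[symmetric])
    then have "?Q \<theta> \<le> ?Q ?\<zeta>" by (rule min)
    also have "?Q ?\<zeta> \<le> (1 - t) * ?Q \<theta> + t * ?Q \<eta> - t * (1 - t) * ?d"
    proof -
      have lin: "(\<Sum>J\<in>UNIV. ?\<zeta> J * g J)
          = (1 - t) * (\<Sum>J\<in>UNIV. \<theta> J * g J) + t * (\<Sum>J\<in>UNIV. \<eta> J * g J)" for g
        by (simp add: distrib_right sum.distrib sum_distrib_left mult.assoc)
      have "lam * KL ?\<zeta> sparsity_prior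
          \<le> lam * ((1 - t) * KL \<theta> sparsity_prior + t * KL \<eta> sparsity_prior)"
        using lam t prob_vectorsD(1)[OF \<theta>P] prob_vectorsD(1)[OF \<eta>]
        by (intro mult_left_mono KL_convex sparsity_prior_pos) auto
      then show ?thesis
        unfolding Q_crit_def lin aggregate_convex_comb norm_convex_comb
        by (simp add: algebra_simps)
    qed
    finally have "t * ((1 - t) * ?d) \<le> t * (?Q \<eta> - ?Q \<theta>)" by (simp add: algebra_simps)
    then show ?thesis using t by (simp add: t_def mult_le_cancel_left)
  qed
  then have "?d \<le> ?Q \<eta> - ?Q \<theta>" by (rule field_le_mult_one_interval)
  then show ?thesis by (simp add: norm_minus_commute)
qed

lemma norm_square_diff_le:
  fixes L :: "'b::real_inner \<Rightarrow> 'c::real_inner"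
  assumes "linear L" and L: "\<And>z. norm (L z) \<le> norm z"
  shows "(norm (L y))\<^sup>2 - (norm (L y'))\<^sup>2 \<le> norm (y - y') * (norm y + norm y')"
proof -
  have "(norm (L y))\<^sup>2 - (norm (L y'))\<^sup>2 = inner (L (y - y')) (L (y + y'))"
    unfolding power2_norm_eq_inner linear_diff[OF assms(1)] linear_add[OF assms(1)]
    by (simp add: inner_diff_left inner_add_right inner_commute[of "L y'" "L y"])
  also have "\<dots> \<le> norm (L (y - y')) * norm (L (y + y'))" by (rule norm_cauchy_schwarz)
  also have "\<dots> \<le> norm (y - y') * (norm y + norm y')"
    by (intro mult_mono L order_trans[OF L norm_triangle_ineq]) auto
  finally show ?thesis .
qed

lemma aggregate_diff: "aggregate X (y - y') \<theta> = aggregate X y \<theta> - aggregate X y' \<theta>"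
  by (simp add: aggregate_def lse_diff scaleR_diff_right sum_subtractf)

lemma residual_aggregate:
  assumes "\<theta> \<in> prob_vectors"
  shows "y - aggregate X y \<theta> = (\<Sum>J\<in>UNIV. \<theta> J *\<^sub>R (y - lse X y J))"
  using prob_vectorsD(2)[OF assms]
  by (simp add: aggregate_def scaleR_diff_right sum_subtractf scaleR_sum_left[symmetric])

lemma norm_convex_sum_le:
  assumes "\<theta> \<in> prob_vectors" and "\<And>J. norm (f J) \<le> c"
  shows "norm (\<Sum>J\<in>UNIV. \<theta> J *\<^sub>R f J) \<le> c"
proof -
  have "norm (\<Sum>J\<in>UNIV. \<theta> J *\<^sub>R f J) \<le> (\<Sum>J\<in>UNIV. \<theta> J * c)"
    using prob_vectorsD(1)[OF assms(1)] assms(2)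
    by (intro sum_norm_le) (auto intro: mult_left_mono)
  then show ?thesis
    using prob_vectorsD(2)[OF assms(1)] by (simp add: sum_distrib_right[symmetric])
qed

lemma norm_lse_le: "norm (lse X y J) \<le> norm y"
proof (rule power2_le_imp_le)
  show "(norm (lse X y J))\<^sup>2 \<le> (norm y)\<^sup>2"
    using norm_lse_pythagoras[of y X J] zero_le_power2[of "norm (y - lse X y J)"] by linarith
qed simp

lemma Q_crit_diff_le:
  assumes \<theta>: "\<theta> \<in> prob_vectors" and \<nu>: "0 \<le> \<nu>" "\<nu> \<le> 1"
  shows "Q_crit \<nu> lam \<sigma> X y \<theta> - Q_crit \<nu> lam \<sigma> X y' \<theta> \<le> norm (y - y') * (norm y + norm y')"
proof -
  let ?D = "norm (y - y') * (norm y + norm y')"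
  have "(norm (y - lse X y J))\<^sup>2 - (norm (y' - lse X y' J))\<^sup>2 \<le> ?D" for J
    by (rule norm_square_diff_le)
      (auto intro!: linearI norm_residual_le simp: lse_add lse_scaleR algebra_simps)
  then have "(\<Sum>J\<in>UNIV. \<theta> J * ((norm (y - lse X y J))\<^sup>2 - (norm (y' - lse X y' J))\<^sup>2))
      \<le> (\<Sum>J\<in>UNIV. \<theta> J * ?D)"
    using prob_vectorsD(1)[OF \<theta>] by (intro sum_mono mult_left_mono) auto
  also have "\<dots> = ?D"
    using prob_vectorsD(2)[OF \<theta>] by (simp add: sum_distrib_right[symmetric])
  finally have a: "(\<Sum>J\<in>UNIV. \<theta> J * (norm (y - lse X y J))\<^sup>2)
      - (\<Sum>J\<in>UNIV. \<theta> J * (norm (y' - lse X y' J))\<^sup>2) \<le> ?D"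
    by (simp add: right_diff_distrib sum_subtractf)
  have b: "(norm (y - aggregate X y \<theta>))\<^sup>2 - (norm (y' - aggregate X y' \<theta>))\<^sup>2 \<le> ?D"
  proof (rule norm_square_diff_le)
    show "linear (\<lambda>y. y - aggregate X y \<theta>)"
      by (rule linearI)
        (simp_all add: aggregate_def lse_add lse_scaleR scaleR_add_right sum.distrib
          scaleR_sum_right scaleR_diff_right mult.commute)
    show "norm (z - aggregate X z \<theta>) \<le> norm z" for z
      unfolding residual_aggregate[OF \<theta>] by (intro norm_convex_sum_le \<theta> norm_residual_le)
  qed
  have "\<nu> * ((\<Sum>J\<in>UNIV. \<theta> J * (norm (y - lse X y J))\<^sup>2)
      - (\<Sum>J\<in>UNIV. \<theta> J * (norm (y' - lse X y' J))\<^sup>2)) \<le> \<nu> * ?D"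
    by (rule mult_left_mono[OF a \<nu>(1)])
  moreover have "(1 - \<nu>) * ((norm (y - aggregate X y \<theta>))\<^sup>2 - (norm (y' - aggregate X y' \<theta>))\<^sup>2)
      \<le> (1 - \<nu>) * ?D"
    using \<nu>(2) by (intro mult_left_mono[OF b]) simp
  ultimately show ?thesis unfolding Q_crit_def by (simp add: algebra_simps)
qed

text \<open>
  Changing the data moves the criterion by a small amount uniformly in the weights; by the
  quadratic gap, minimisers of nearby criteria have nearby aggregates.
\<close>
lemma Q_weights_stable:
  assumes \<theta>: "\<theta> \<in> Q_weights \<nu> lam \<sigma> X y" and \<theta>': "\<theta>' \<in> Q_weights \<nu> lam \<sigma> X y'"
    and lam: "0 \<le> lam" and \<nu>: "0 \<le> \<nu>" "\<nu> < 1"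
  shows "norm (aggregate X y' \<theta>' - aggregate X y \<theta>)
    \<le> norm (y' - y) + sqrt (2 * norm (y' - y) * (norm y' + norm y) / (1 - \<nu>))"
proof -
  have P: "\<theta> \<in> prob_vectors" "\<theta>' \<in> prob_vectors"
    and min': "Q_crit \<nu> lam \<sigma> X y' \<theta>' \<le> Q_crit \<nu> lam \<sigma> X y' \<theta>"
    using \<theta> \<theta>' by (auto simp: Q_weights_def is_arg_min_linorder)
  have "(1 - \<nu>) * (norm (aggregate X y \<theta>' - aggregate X y \<theta>))\<^sup>2
      \<le> Q_crit \<nu> lam \<sigma> X y \<theta>' - Q_crit \<nu> lam \<sigma> X y \<theta>"
    using Q_weights_gap[OF \<theta> P(2) lam] \<nu> by simp
  also have "\<dots> \<le> 2 * (norm (y' - y) * (norm y' + norm y))"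
    using min' Q_crit_diff_le[OF P(2), of \<nu> lam \<sigma> X y y'] Q_crit_diff_le[OF P(1), of \<nu> lam \<sigma> X y' y] \<nu>
    by (simp add: norm_minus_commute[of y] add.commute[of "norm y"])
  finally have "(norm (aggregate X y \<theta>' - aggregate X y \<theta>))\<^sup>2
      \<le> 2 * norm (y' - y) * (norm y' + norm y) / (1 - \<nu>)"
    using \<nu> by (simp add: field_simps)
  then have "norm (aggregate X y \<theta>' - aggregate X y \<theta>)
      \<le> sqrt (2 * norm (y' - y) * (norm y' + norm y) / (1 - \<nu>))"
    by (rule real_le_rsqrt)
  moreover have "norm (aggregate X y' \<theta>' - aggregate X y \<theta>') \<le> norm (y' - y)"
    unfolding aggregate_diff[symmetric]
    unfolding aggregate_def by (intro norm_convex_sum_le P norm_lse_le)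
  moreover have "norm (aggregate X y' \<theta>' - aggregate X y \<theta>)
      \<le> norm (aggregate X y' \<theta>' - aggregate X y \<theta>') + norm (aggregate X y \<theta>' - aggregate X y \<theta>)"
    using norm_triangle_ineq[of "aggregate X y' \<theta>' - aggregate X y \<theta>'" "aggregate X y \<theta>' - aggregate X y \<theta>"]
    by simp
  ultimately show ?thesis by linarith
qed

text \<open>
  Nothing is assumed on how a minimiser is selected for each outcome. The aggregate is measurable
  nevertheless, because stability makes it a continuous function of the data.
\<close>
lemma borel_measurable_Q_aggregate:
  fixes X :: "real^'p^'n" and Y :: "'a \<Rightarrow> real^'n"
  assumes Y: "Y \<in> borel_measurable M"
    and \<theta>: "\<And>\<omega>. \<omega> \<in> space M \<Longrightarrow> \<theta> \<omega> \<in> Q_weights \<nu> lam \<sigma> X (Y \<omega>)"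
    and lam: "0 \<le> lam" and \<nu>: "0 \<le> \<nu>" "\<nu> < 1"
  shows "(\<lambda>\<omega>. aggregate X (Y \<omega>) (\<theta> \<omega>)) \<in> borel_measurable M"
proof -
  define D where "D = {y. Q_weights \<nu> lam \<sigma> X y \<noteq> {}}"
  define G where "G y = aggregate X y (SOME \<tau>. \<tau> \<in> Q_weights \<nu> lam \<sigma> X y)" for y
  have some: "(SOME \<tau>. \<tau> \<in> Q_weights \<nu> lam \<sigma> X y) \<in> Q_weights \<nu> lam \<sigma> X y" if "y \<in> D" for y
    using that by (simp add: D_def some_in_eq)
  have "continuous_on D G"
    unfolding continuous_on_def
  proof
    fix y assume y: "y \<in> D"
    let ?b = "\<lambda>y'. norm (y' - y) + sqrt (2 * norm (y' - y) * (norm y' + norm y) / (1 - \<nu>))"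
    have "(?b \<longlongrightarrow> ?b y) (at y within D)"
      using \<nu> by (intro tendsto_intros) auto
    then have "(?b \<longlongrightarrow> 0) (at y within D)" by simp
    moreover have "\<forall>\<^sub>F y' in at y within D. norm (G y' - G y) \<le> ?b y'"
      unfolding eventually_at_filter G_def
    proof (intro always_eventually allI impI)
      fix y' assume "y' \<in> D"
      show "norm (aggregate X y' (SOME \<tau>. \<tau> \<in> Q_weights \<nu> lam \<sigma> X y')
          - aggregate X y (SOME \<tau>. \<tau> \<in> Q_weights \<nu> lam \<sigma> X y)) \<le> ?b y'"
        by (rule Q_weights_stable[OF some[OF y] some[OF \<open>y' \<in> D\<close>] lam \<nu>])
    qed
    ultimately have "((\<lambda>y'. G y' - G y) \<longlongrightarrow> 0) (at y within D)"
      by (rule Lim_null_comparison[rotated])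
    then show "(G \<longlongrightarrow> G y) (at y within D)" by (simp add: LIM_zero_iff)
  qed
  then have "G \<in> borel_measurable (restrict_space borel D)"
    by (rule borel_measurable_continuous_on_restrict)
  moreover have "Y \<in> measurable M (restrict_space borel D)"
    using Y \<theta> by (intro measurable_restrict_space2) (auto simp: D_def)
  ultimately have "(\<lambda>\<omega>. G (Y \<omega>)) \<in> borel_measurable M"
    by (rule measurable_compose[rotated])
  moreover have "aggregate X (Y \<omega>) (\<theta> \<omega>) = G (Y \<omega>)" if "\<omega> \<in> space M" for \<omega>
  proof -
    have "Y \<omega> \<in> D" using \<theta>[OF that] by (auto simp: D_def)
    then show ?thesis
      using Q_weights_stable[OF some[OF \<open>Y \<omega> \<in> D\<close>] \<theta>[OF that] lam \<nu>] unfolding G_def by simp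
  qed
  ultimately show ?thesis by (simp cong: measurable_cong)
qed


section \<open>Deterministic oracle inequalities\<close>

text \<open>
  The random part of the bounds is the log-partition function of these potentials \<open>h\<^sub>J\<close>, where
  \<open>w\<^sub>J\<close> and \<open>c\<^sub>J\<close> are deterministic. The noise enters the potential of \<open>J\<close> only through a
  linear functional and \<open>\<parallel>A\<^sub>J \<xi>\<parallel>\<^sup>2\<close>.
\<close>
definition noise_potential ::
    "real \<Rightarrow> real^'p^'n \<Rightarrow> ('p set \<Rightarrow> real^'n) \<Rightarrow> ('p set \<Rightarrow> real) \<Rightarrow> real^'n \<Rightarrow> 'p set \<Rightarrow> real" where
  "noise_potential \<sigma> X w c x J =
     inner (w J) x - c J + (2 * (norm (lse X x J))\<^sup>2 - lse_pen \<sigma> X J)"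

definition log_partition :: "real \<Rightarrow> ('p::finite set \<Rightarrow> real) \<Rightarrow> real" where
  "log_partition lam h = lam * ln (\<Sum>J\<in>UNIV. sparsity_prior J * exp (h J / lam))"

lemma partition_sum_pos: "0 < (\<Sum>J\<in>UNIV. sparsity_prior (J :: 'p::finite set) * exp (g J))"
  by (intro sum_pos mult_pos_pos sparsity_prior_pos) auto

lemma lse_loss_decomp:
  "(norm (lse X (\<mu> + x) J - \<mu>))\<^sup>2 = (norm (\<mu> - lse X \<mu> J))\<^sup>2 + (norm (lse X x J))\<^sup>2"
proof -
  have "inner (\<mu> - lse X \<mu> J) (lse X x J) = 0"
    by (rule inner_residual_span[OF lse_in_span])
  then have "orthogonal (lse X x J) (- (\<mu> - lse X \<mu> J))"
    by (simp only: orthogonal_def inner_minus_right inner_commute[of "lse X x J"] minus_zero)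
  then have "(norm (lse X x J + - (\<mu> - lse X \<mu> J)))\<^sup>2
      = (norm (lse X x J))\<^sup>2 + (norm (- (\<mu> - lse X \<mu> J)))\<^sup>2"
    by (rule norm_add_Pythagorean)
  moreover have "lse X x J + - (\<mu> - lse X \<mu> J) = lse X (\<mu> + x) J - \<mu>" by (simp add: lse_add)
  ultimately show ?thesis by (simp only: norm_minus_cancel add.commute)
qed

lemma data_fit_eq:
  fixes f :: "'b::real_inner"
  shows "(norm (\<mu> + x - f))\<^sup>2 = (norm (f - \<mu>))\<^sup>2 + 2 * inner x (\<mu> - f) + (norm x)\<^sup>2"
  unfolding power2_norm_eq_inner
  by (simp add: inner_diff_left inner_diff_right inner_add_left inner_add_right inner_commute)

text \<open>
  The term \<open>\<parallel>A\<^sub>K x\<parallel>\<^sup>2\<close> in the loss of the reference estimator is moved into the potentials,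
  where \<open>- 2 \<parallel>A\<^sub>K x\<parallel>\<^sup>2\<close> outweighs it, so no separate deviation bound is spent on it. The variance
  of the weights and the convexity gap add up to half the mean of \<open>\<parallel>A\<^sub>J y - A\<^sub>K y\<parallel>\<^sup>2\<close> by the
  bias-variance identity; the part \<open>\<parallel>v J\<parallel>\<^sup>2 / 2\<close> of it dominates the linear noise, and its cross
  term is the correction of \<open>2 v J\<close> in \<open>w J\<close>.
\<close>
lemma Q_aggregate_oracle:
  fixes X :: "real^'p^'n" and \<mu> x :: "real^'n" and K :: "'p set"
  defines "v \<equiv> \<lambda>J. lse X \<mu> J - lse X \<mu> K"
  defines "w \<equiv> \<lambda>J. 2 *\<^sub>R v J - (lse X (v J) J - lse X (v J) K)"
  assumes \<theta>: "\<theta> \<in> Q_weights (1 / 2) lam \<sigma> X (\<mu> + x)" and lam: "0 < lam"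
  shows "(norm (aggregate X (\<mu> + x) \<theta> - \<mu>))\<^sup>2
    \<le> (norm (\<mu> - lse X \<mu> K))\<^sup>2 + lse_pen \<sigma> X K - lam * ln (sparsity_prior K)
      + log_partition lam (noise_potential \<sigma> X w (\<lambda>J. (norm (v J))\<^sup>2 / 2) x)"
proof -
  define y where "y = \<mu> + x"
  define f where "f J = lse X y J" for J
  define a where "a = aggregate X y \<theta>"
  have aS: "a = (\<Sum>J\<in>UNIV. \<theta> J *\<^sub>R f J)" by (simp add: a_def aggregate_def f_def)
  have \<theta>P: "\<theta> \<in> prob_vectors" using \<theta> by (auto simp: Q_weights_def is_arg_min_linorder)
  note s1 = prob_vectorsD(2)[OF \<theta>P]
  define e where "e J = (if J = K then 1 else 0 :: real)" for J
  have eP: "e \<in> prob_vectors" by (simp add: prob_vectors_def e_def)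
  have esum: "(\<Sum>J\<in>UNIV. e J * g J) = g K" for g
    by (simp add: e_def if_distrib[of "\<lambda>u. u * _"] cong: if_cong)
  have eagg: "aggregate X y e = f K"
    by (simp add: aggregate_def f_def e_def if_distrib[of "\<lambda>u. u *\<^sub>R _"] cong: if_cong)
  have eKL: "KL e sparsity_prior = - ln (sparsity_prior K)"
    unfolding KL_def esum using sparsity_prior_pos[of K] by (simp add: e_def ln_div)
  have Qe: "Q_crit (1 / 2) lam \<sigma> X y e
      = (norm (y - f K))\<^sup>2 + lse_pen \<sigma> X K - lam * ln (sparsity_prior K)"
    unfolding Q_crit_def esum eagg eKL f_def by simp
  have Q\<theta>: "Q_crit (1 / 2) lam \<sigma> X y \<theta>
      = (norm (y - a))\<^sup>2 + (\<Sum>J\<in>UNIV. \<theta> J * (norm (f J - a))\<^sup>2) / 2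
        + (\<Sum>J\<in>UNIV. \<theta> J * lse_pen \<sigma> X J) + lam * KL \<theta> sparsity_prior"
    using bias_variance[OF s1 aS, of y]
    by (simp add: Q_crit_def a_def[symmetric] f_def[symmetric] norm_minus_commute[of y]
        add_divide_distrib)
  have gap: "Q_crit (1 / 2) lam \<sigma> X y \<theta> + (norm (f K - a))\<^sup>2 / 2 \<le> Q_crit (1 / 2) lam \<sigma> X y e"
    using Q_weights_gap[OF \<theta>[folded y_def] eP] lam by (simp add: eagg a_def)
  define T where "T J = 2 * inner x (f J - f K) - (norm (f J - f K))\<^sup>2 / 2 - lse_pen \<sigma> X J
      + (norm (lse X x K))\<^sup>2" for J
  have Tsum: "(\<Sum>J\<in>UNIV. \<theta> J * T J) = 2 * inner x (a - f K)
      - ((\<Sum>J\<in>UNIV. \<theta> J * (norm (f J - a))\<^sup>2) + (norm (a - f K))\<^sup>2) / 2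
      - (\<Sum>J\<in>UNIV. \<theta> J * lse_pen \<sigma> X J) + (norm (lse X x K))\<^sup>2"
  proof -
    have "(\<Sum>J\<in>UNIV. \<theta> J * inner x (f J - f K)) = inner x (a - f K)"
      using s1 by (simp add: aS inner_diff_right inner_sum_right right_diff_distrib sum_subtractf
          sum_distrib_right[symmetric])
    moreover have "\<theta> J * T J = 2 * (\<theta> J * inner x (f J - f K)) - \<theta> J * (norm (f J - f K))\<^sup>2 / 2
        - \<theta> J * lse_pen \<sigma> X J + \<theta> J * (norm (lse X x K))\<^sup>2" for J
      unfolding T_def by (simp add: algebra_simps)
    ultimately show ?thesis
      using s1 bias_variance[OF s1 aS, of "f K"]
      by (simp add: sum.distrib sum_subtractf sum_distrib_left[symmetric]
          sum_divide_distrib[symmetric] sum_distrib_right[symmetric])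
  qed
  have fit: "(norm (y - g))\<^sup>2 = (norm (g - \<mu>))\<^sup>2 + 2 * inner x (\<mu> - g) + (norm x)\<^sup>2" for g
    unfolding y_def by (rule data_fit_eq)
  have loss: "(norm (f K - \<mu>))\<^sup>2 = (norm (\<mu> - lse X \<mu> K))\<^sup>2 + (norm (lse X x K))\<^sup>2"
    unfolding f_def y_def by (rule lse_loss_decomp)
  have "(norm (a - \<mu>))\<^sup>2 \<le> (norm (\<mu> - lse X \<mu> K))\<^sup>2 + lse_pen \<sigma> X K - lam * ln (sparsity_prior K)
      + ((\<Sum>J\<in>UNIV. \<theta> J * T J) - lam * KL \<theta> sparsity_prior)"
    using gap unfolding Qe Q\<theta> fit loss Tsum
    by (simp add: norm_minus_commute[of "f K" a] inner_diff_right add_divide_distrib)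
  also have "(\<Sum>J\<in>UNIV. \<theta> J * T J)
      \<le> (\<Sum>J\<in>UNIV. \<theta> J * noise_potential \<sigma> X w (\<lambda>J. (norm (v J))\<^sup>2 / 2) x J)"
  proof (rule sum_mono, rule mult_left_mono)
    fix J
    define d where "d = lse X x J - lse X x K"
    have fd: "f J - f K = v J + d" by (simp add: f_def y_def v_def d_def lse_add)
    have "inner x d = (norm (lse X x J))\<^sup>2 - (norm (lse X x K))\<^sup>2"
      by (simp add: d_def inner_diff_right inner_commute[of x] inner_lse_self)
    moreover have "inner (v J) d = inner (lse X (v J) J - lse X (v J) K) x"
      by (simp add: d_def inner_diff_right inner_diff_left lse_symmetric)
    moreover have "(norm (v J + d))\<^sup>2 = (norm (v J))\<^sup>2 + 2 * inner (v J) d + (norm d)\<^sup>2"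
      using dot_norm[of "v J" d] by simp
    moreover have "inner (w J) x = 2 * inner x (v J) - inner (lse X (v J) J - lse X (v J) K) x"
      unfolding w_def inner_diff_left by (simp add: inner_commute)
    ultimately show "T J \<le> noise_potential \<sigma> X w (\<lambda>J. (norm (v J))\<^sup>2 / 2) x J"
      unfolding T_def fd noise_potential_def inner_add_right
      using zero_le_power2[of "norm d"] zero_le_power2[of "norm (lse X x K)"] by argo
  qed (rule prob_vectorsD(1)[OF \<theta>P])
  also have "(\<Sum>J\<in>UNIV. \<theta> J * noise_potential \<sigma> X w (\<lambda>J. (norm (v J))\<^sup>2 / 2) x J)
        - lam * KL \<theta> sparsity_prior
      \<le> log_partition lam (noise_potential \<sigma> X w (\<lambda>J. (norm (v J))\<^sup>2 / 2) x)"
    unfolding log_partition_def by (rule gibbs_variational[OF \<theta>P sparsity_prior_pos lam])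
  finally show ?thesis by (simp add: a_def y_def)
qed

lemma EW_weights_prob: "EW_weights lam \<sigma> X y \<in> prob_vectors"
proof -
  have "(\<Sum>K\<in>UNIV. sparsity_prior K
      * exp (- ((norm (y - lse X y K))\<^sup>2 + lse_pen \<sigma> X K) / lam)) > 0"
    by (rule partition_sum_pos)
  then show ?thesis
    by (auto simp: prob_vectors_def EW_weights_def Let_def sum_divide_distrib[symmetric]
        intro!: divide_nonneg_pos mult_nonneg_nonneg sparsity_prior_pos[THEN less_imp_le])
qed

lemma EW_weights_optimal:
  fixes X :: "real^'p^'n" and y :: "real^'n" and \<sigma> :: real and K :: "'p set"
  assumes lam: "0 < lam"
  defines "\<theta> \<equiv> EW_weights lam \<sigma> X y"
  shows "(\<Sum>J\<in>UNIV. \<theta> J * ((norm (y - lse X y J))\<^sup>2 + lse_pen \<sigma> X J)) + lam * KL \<theta> sparsity_prior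
    \<le> (norm (y - lse X y K))\<^sup>2 + lse_pen \<sigma> X K - lam * ln (sparsity_prior K)"
proof -
  define E where "E J = (norm (y - lse X y J))\<^sup>2 + lse_pen \<sigma> X J" for J
  define u where "u J = sparsity_prior J * exp (- E J / lam)" for J
  define W where "W = (\<Sum>J\<in>UNIV. u J)"
  have u: "u J > 0" for J unfolding u_def by (simp add: sparsity_prior_pos)
  have W: "W > 0" unfolding W_def using u by (intro sum_pos) auto
  have \<theta>: "\<theta> J = u J / W" for J
    by (simp add: \<theta>_def EW_weights_def Let_def u_def E_def W_def)
  have "\<theta> J * E J + lam * (\<theta> J * ln (\<theta> J / sparsity_prior J)) = \<theta> J * (- lam * ln W)" for J
  proof -
    have "\<theta> J / sparsity_prior J = exp (- E J / lam) / W"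
      using sparsity_prior_pos[of J] by (simp add: \<theta> u_def)
    then have "ln (\<theta> J / sparsity_prior J) = - E J / lam - ln W"
      using W by (simp add: ln_div)
    then have "lam * ln (\<theta> J / sparsity_prior J) = - E J - lam * ln W"
      using lam by (simp add: right_diff_distrib)
    moreover have "\<theta> J * E J + lam * (\<theta> J * ln (\<theta> J / sparsity_prior J))
        = \<theta> J * (E J + lam * ln (\<theta> J / sparsity_prior J))"
      by (simp add: algebra_simps)
    ultimately show ?thesis by simp
  qed
  then have "(\<Sum>J\<in>UNIV. \<theta> J * E J) + lam * KL \<theta> sparsity_prior = (\<Sum>J\<in>UNIV. \<theta> J * (- lam * ln W))"
    unfolding KL_def sum_distrib_left sum.distrib[symmetric] by simp
  also have "\<dots> = - lam * ln W"
    unfolding \<theta>_def sum_distrib_right[symmetric] prob_vectorsD(2)[OF EW_weights_prob] by simp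
  also have "\<dots> \<le> - lam * ln (u K)"
  proof -
    have "u K \<le> W" unfolding W_def using u by (intro member_le_sum) (auto intro: less_imp_le)
    then have "ln (u K) \<le> ln W" using u by (intro ln_mono) auto
    then show ?thesis using lam by simp
  qed
  also have "ln (u K) = ln (sparsity_prior K) - E K / lam"
    unfolding u_def using sparsity_prior_pos[of K] by (simp add: ln_mult)
  also have "- lam * (ln (sparsity_prior K) - E K / lam) = E K - lam * ln (sparsity_prior K)"
    using lam by (simp add: field_simps)
  finally show ?thesis by (simp add: E_def)
qed

text \<open>
  The criterion of exponential weights has no quadratic part in the aggregate. Instead, a
  share \<open>s\<close> of the loss is sacrificed to dominate the linear noise, and the reference set pays the
  same share of its own bias; this is why the leading constant exceeds one.
\<close>
lemma EW_oracle:
  fixes X :: "real^'p^'n" and \<mu> x :: "real^'n" and K :: "'p set"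
  defines "b \<equiv> \<lambda>J. \<mu> - lse X \<mu> J"
  assumes lam: "0 < lam" and s: "0 \<le> s" "s \<le> 1"
  shows "(1 - s) * (norm (aggregate X (\<mu> + x) (EW_weights lam \<sigma> X (\<mu> + x)) - \<mu>))\<^sup>2
    \<le> (1 + s) * (norm (b K))\<^sup>2 + lse_pen \<sigma> X K - lam * ln (sparsity_prior K)
      + log_partition lam (noise_potential \<sigma> X (\<lambda>J. 2 *\<^sub>R (b K - b J))
          (\<lambda>J. s * ((norm (b K))\<^sup>2 + (norm (b J))\<^sup>2)) x)"
proof -
  define y where "y = \<mu> + x"
  define \<theta> where "\<theta> = EW_weights lam \<sigma> X y"
  let ?h = "noise_potential \<sigma> X (\<lambda>J. 2 *\<^sub>R (b K - b J)) (\<lambda>J. s * ((norm (b K))\<^sup>2 + (norm (b J))\<^sup>2)) x"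
  have \<theta>P: "\<theta> \<in> prob_vectors" unfolding \<theta>_def by (rule EW_weights_prob)
  note s1 = prob_vectorsD(2)[OF \<theta>P]
  have loss: "(norm (lse X y J - \<mu>))\<^sup>2 = (norm (b J))\<^sup>2 + (norm (lse X x J))\<^sup>2" for J
    unfolding y_def b_def by (rule lse_loss_decomp)
  have fit: "(norm (y - lse X y J))\<^sup>2
      = (norm (b J))\<^sup>2 + 2 * inner (b J) x - (norm (lse X x J))\<^sup>2 + (norm x)\<^sup>2" for J
  proof -
    have "inner x (\<mu> - lse X y J) = inner (b J) x - (norm (lse X x J))\<^sup>2"
      by (simp add: y_def b_def lse_add inner_diff_right inner_diff_left inner_add_right
          inner_lse_self[symmetric] inner_commute[of x])
    then show ?thesis
      using data_fit_eq[of \<mu> x "lse X y J"] loss[of J] by (simp add: y_def)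
  qed
  have "(norm (aggregate X y \<theta> - \<mu>))\<^sup>2 \<le> (\<Sum>J\<in>UNIV. \<theta> J * (norm (lse X y J - \<mu>))\<^sup>2)"
  proof -
    have "0 \<le> (\<Sum>J\<in>UNIV. \<theta> J * (norm (lse X y J - aggregate X y \<theta>))\<^sup>2)"
      using prob_vectorsD(1)[OF \<theta>P] by (intro sum_nonneg) auto
    then show ?thesis
      using bias_variance[OF s1, of "aggregate X y \<theta>" "lse X y" \<mu>] by (simp add: aggregate_def)
  qed
  then have "(1 - s) * (norm (aggregate X y \<theta> - \<mu>))\<^sup>2
      \<le> (1 - s) * (\<Sum>J\<in>UNIV. \<theta> J * (norm (lse X y J - \<mu>))\<^sup>2)"
    using s by (intro mult_left_mono) auto
  also have "\<dots> = (\<Sum>J\<in>UNIV. \<theta> J * ((1 - s) * ((norm (b J))\<^sup>2 + (norm (lse X x J))\<^sup>2)))"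
    unfolding loss sum_distrib_left by (simp add: mult.left_commute)
  also have "\<dots> \<le> (\<Sum>J\<in>UNIV. \<theta> J * (((norm (y - lse X y J))\<^sup>2 + lse_pen \<sigma> X J)
      + (?h J - (norm x)\<^sup>2 - 2 * inner (b K) x + s * (norm (b K))\<^sup>2)))"
  proof (rule sum_mono, rule mult_left_mono)
    fix J
    have "0 \<le> s * (norm (lse X x J))\<^sup>2" using s by simp
    moreover have "?h J = 2 * inner (b K) x - 2 * inner (b J) x
        - s * (norm (b K))\<^sup>2 - s * (norm (b J))\<^sup>2 + 2 * (norm (lse X x J))\<^sup>2 - lse_pen \<sigma> X J"
      by (simp add: noise_potential_def inner_diff_left algebra_simps)
    ultimately show "(1 - s) * ((norm (b J))\<^sup>2 + (norm (lse X x J))\<^sup>2)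
        \<le> ((norm (y - lse X y J))\<^sup>2 + lse_pen \<sigma> X J)
          + (?h J - (norm x)\<^sup>2 - 2 * inner (b K) x + s * (norm (b K))\<^sup>2)"
      unfolding fit by (simp add: algebra_simps)
  qed (rule prob_vectorsD(1)[OF \<theta>P])
  also have "\<dots> = (\<Sum>J\<in>UNIV. \<theta> J * ((norm (y - lse X y J))\<^sup>2 + lse_pen \<sigma> X J))
      + (\<Sum>J\<in>UNIV. \<theta> J * ?h J) + (\<Sum>J\<in>UNIV. \<theta> J) * (- (norm x)\<^sup>2 - 2 * inner (b K) x + s * (norm (b K))\<^sup>2)"
    unfolding sum_distrib_right sum.distrib[symmetric] by (intro sum.cong) (auto simp: algebra_simps)
  also have "\<dots> \<le> (norm (y - lse X y K))\<^sup>2 + lse_pen \<sigma> X K - lam * ln (sparsity_prior K)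
      + ((\<Sum>J\<in>UNIV. \<theta> J * ?h J) - lam * KL \<theta> sparsity_prior)
      - (norm x)\<^sup>2 - 2 * inner (b K) x + s * (norm (b K))\<^sup>2"
    using EW_weights_optimal[OF lam, of \<sigma> X y K] unfolding s1 \<theta>_def[symmetric] by simp
  also have "\<dots> \<le> (norm (b K))\<^sup>2 + lse_pen \<sigma> X K - lam * ln (sparsity_prior K)
      + log_partition lam ?h + s * (norm (b K))\<^sup>2"
    using gibbs_variational[where \<pi> = sparsity_prior and h = ?h, OF \<theta>P sparsity_prior_pos lam]
      zero_le_power2[of "norm (lse X x K)"]
    unfolding fit log_partition_def by linarith
  finally show ?thesis by (simp add: \<theta>_def y_def algebra_simps)
qed

lemma continuous_on_EW_aggregate:
  "continuous_on UNIV (\<lambda>y. aggregate X y (EW_weights lam \<sigma> X y))"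
proof -
  have "(\<Sum>K\<in>UNIV. sparsity_prior K
      * exp (- ((norm (y - lse X y K))\<^sup>2 + lse_pen \<sigma> X K) / lam)) \<noteq> 0" for y
    by (rule less_imp_neq[OF partition_sum_pos, THEN not_sym])
  then show ?thesis
    unfolding aggregate_def EW_weights_def Let_def divide_inverse
    by (intro continuous_intros) auto
qed

section \<open>Deviation\<close>

text \<open>
  Markov's inequality for the partition function, whose mean is at most one because the prior
  has total mass one and each exponential moment is at most one.
\<close>
lemma log_partition_deviation:
  fixes \<xi> :: "'a \<Rightarrow> real^'n" and X :: "real^'p^'n"
  assumes M: "prob_space M" and \<sigma>: "0 < \<sigma>" and iso: "iso_normal M \<sigma> \<xi>"
    and lam: "16 * \<sigma>\<^sup>2 \<le> lam" and c: "\<And>J. \<sigma>\<^sup>2 * (norm (w J))\<^sup>2 \<le> lam * c J"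
    and \<delta>: "0 < \<delta>" and Z: "Z \<in> borel_measurable M"
    and le: "\<And>\<omega>. \<omega> \<in> space M \<Longrightarrow>
      Z \<omega> \<le> r + log_partition lam (noise_potential \<sigma> X w c (\<xi> \<omega>))"
  shows "1 - \<delta> \<le> measure M {\<omega> \<in> space M. Z \<omega> \<le> r + lam * ln (1 / \<delta>)}"
proof -
  interpret prob_space M by fact
  have [measurable]: "\<xi> \<in> borel_measurable M" by (rule iso_normal_measurable[OF iso])
  note [measurable] = Z
  have lam0: "lam > 0" using lam \<sigma> by (smt (verit) zero_less_power)
  let ?h = "\<lambda>\<omega>. noise_potential \<sigma> X w c (\<xi> \<omega>)"
  define S where "S \<omega> = (\<Sum>J\<in>UNIV. sparsity_prior J * exp (?h \<omega> J / lam))" for \<omega>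
  have S: "S \<omega> > 0" for \<omega> unfolding S_def by (rule partition_sum_pos)
  have [measurable]: "(\<lambda>x. lse X x J) \<in> borel_measurable borel" for J
    by (intro borel_measurable_continuous_onI continuous_intros)
  have hm [measurable]: "(\<lambda>\<omega>. ?h \<omega> J) \<in> borel_measurable M" for J
    unfolding noise_potential_def by measurable
  have Sm [measurable]: "(\<lambda>\<omega>. S \<omega>) \<in> borel_measurable M" unfolding S_def by measurable
  have \<pi>0: "0 \<le> sparsity_prior J" for J :: "'p set" using sparsity_prior_pos[of J] by simp
  have "ennreal (S \<omega>) = (\<Sum>J\<in>UNIV. ennreal (sparsity_prior J) * ennreal (exp (?h \<omega> J / lam)))" for \<omega>
  proof -
    have "ennreal (S \<omega>) = (\<Sum>J\<in>UNIV. ennreal (sparsity_prior J * exp (?h \<omega> J / lam)))"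
      unfolding S_def by (rule sum_ennreal[symmetric]) (simp add: \<pi>0)
    then show ?thesis by (simp add: ennreal_mult' \<pi>0)
  qed
  then have "(\<integral>\<^sup>+\<omega>. ennreal (S \<omega>) \<partial>M)
      = (\<integral>\<^sup>+\<omega>. (\<Sum>J\<in>UNIV. ennreal (sparsity_prior J) * ennreal (exp (?h \<omega> J / lam))) \<partial>M)"
    by simp
  also have "\<dots> = (\<Sum>J\<in>UNIV. ennreal (sparsity_prior J) * (\<integral>\<^sup>+\<omega>. ennreal (exp (?h \<omega> J / lam)) \<partial>M))"
    by (simp add: nn_integral_sum nn_integral_cmult)
  also have "\<dots> \<le> (\<Sum>J\<in>(UNIV :: 'p set set). ennreal (sparsity_prior J) * 1)"
    unfolding noise_potential_def
    by (intro sum_mono mult_left_mono iso_normal_exp_penalised[OF M \<sigma> iso lam c]) auto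
  also have "\<dots> = 1"
    by (simp add: sum_ennreal \<pi>0 sum_sparsity_prior)
  finally have ES: "(\<integral>\<^sup>+\<omega>. ennreal (S \<omega>) \<partial>M) \<le> 1" .
  define B where "B = {\<omega> \<in> space M. 1 \<le> ennreal \<delta> * ennreal (S \<omega>)}"
  have B: "B \<in> sets M" unfolding B_def by measurable
  have "emeasure M B \<le> ennreal \<delta> * (\<integral>\<^sup>+\<omega>. ennreal (S \<omega>) * indicator (space M) \<omega> \<partial>M)"
    unfolding B_def by (rule nn_integral_Markov_inequality) auto
  also have "(\<integral>\<^sup>+\<omega>. ennreal (S \<omega>) * indicator (space M) \<omega> \<partial>M) = (\<integral>\<^sup>+\<omega>. ennreal (S \<omega>) \<partial>M)"
    by (intro nn_integral_cong) simp
  also have "ennreal \<delta> * (\<integral>\<^sup>+\<omega>. ennreal (S \<omega>) \<partial>M) \<le> ennreal \<delta> * 1"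
    using ES by (intro mult_left_mono) auto
  finally have "measure M B \<le> \<delta>"
    using \<delta> by (simp add: emeasure_eq_measure)
  then have "1 - \<delta> \<le> measure M (space M - B)"
    using prob_compl[OF B] by simp
  also have "\<dots> \<le> measure M {\<omega> \<in> space M. Z \<omega> \<le> r + lam * ln (1 / \<delta>)}"
  proof (rule finite_measure_mono)
    show "space M - B \<subseteq> {\<omega> \<in> space M. Z \<omega> \<le> r + lam * ln (1 / \<delta>)}"
    proof
      fix \<omega> assume \<omega>: "\<omega> \<in> space M - B"
      then have "\<not> 1 \<le> \<delta> * S \<omega>"
        using \<delta> by (auto simp: B_def ennreal_mult'[symmetric])
      then have "S \<omega> \<le> 1 / \<delta>" using \<delta> by (simp add: field_simps)
      then have "lam * ln (S \<omega>) \<le> lam * ln (1 / \<delta>)"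
        using S[of \<omega>] lam0 by (intro mult_left_mono ln_mono) auto
      then show "\<omega> \<in> {\<omega> \<in> space M. Z \<omega> \<le> r + lam * ln (1 / \<delta>)}"
        using le[of \<omega>] \<omega> by (simp add: log_partition_def S_def)
    qed
  qed measurable
  finally show ?thesis .
qed

section \<open>Sparsity oracle inequalities\<close>

text \<open>
  Among the vectors with a given support \<open>J\<close>, none approximates \<open>\<mu>\<close> better than the projection
  \<open>A\<^sub>J \<mu>\<close>, and all have the same complexity. The infimum thus dominates the minimum over the
  finitely many supports, and the deviation bound is applied to one optimal support only, without
  a union bound.
\<close>
lemma sparsity_oracle_deviation:
  fixes X :: "real^'p^'n" and \<mu> :: "real^'n" and Z :: "'a \<Rightarrow> real"
  assumes M: "prob_space M" and Z: "Z \<in> borel_measurable M"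
    and \<delta>: "0 < \<delta>" "\<delta> < 1" and k: "0 \<le> k" and lam: "0 \<le> lam"
    and kC: "\<kappa> * 2 * (lam + 2 * \<sigma>\<^sup>2) \<le> C" and \<kappa>: "0 \<le> \<kappa>"
    and dev: "\<And>J. 1 - \<delta> \<le> measure M {\<omega> \<in> space M. Z \<omega> \<le> k * (norm (\<mu> - lse X \<mu> J))\<^sup>2
      + \<kappa> * (lse_pen \<sigma> X J - lam * ln (sparsity_prior J) + lam * ln (1 / \<delta>))}"
  shows "1 - \<delta> \<le> measure M {\<omega> \<in> space M. Z \<omega> \<le> (INF \<beta>. k * (norm (X *v \<beta> - \<mu>))\<^sup>2
      + C * l0 \<beta> * ln (2 * exp 1 * real CARD('p) / (l0 \<beta> * \<delta>)))}"
proof -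
  interpret prob_space M by fact
  define r where "r J = k * (norm (\<mu> - lse X \<mu> J))\<^sup>2
      + \<kappa> * (lse_pen \<sigma> X J - lam * ln (sparsity_prior J) + lam * ln (1 / \<delta>))" for J
  let ?b = "\<lambda>\<beta>. k * (norm (X *v \<beta> - \<mu>))\<^sup>2
      + C * l0 \<beta> * ln (2 * exp 1 * real CARD('p) / (l0 \<beta> * \<delta>))"
  have rb: "r {j. \<beta> $ j \<noteq> 0} \<le> ?b \<beta>" for \<beta>
  proof -
    let ?J = "{j. \<beta> $ j \<noteq> 0}"
    let ?L = "ln (2 * exp 1 * real CARD('p) / (l0 \<beta> * \<delta>))"
    have l0: "real (max 1 (card ?J)) = l0 \<beta>"
    proof (cases "\<beta> = 0")
      case False
      then have "?J \<noteq> {}" by (auto simp: vec_eq_iff)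
      then have "card ?J \<ge> 1" by (simp add: Suc_le_eq card_gt_0_iff)
      then show ?thesis using False by (simp add: l0_def max_absorb2)
    qed (simp add: l0_def)
    have "l0 \<beta> \<ge> 1" unfolding l0[symmetric] by simp
    have "X *v \<beta> = (\<Sum>j\<in>?J. \<beta> $ j *\<^sub>R column j X)"
      unfolding matrix_mult_sum scalar_mult_eq_scaleR by (intro sum.mono_neutral_right) auto
    also have "\<dots> \<in> span ((\<lambda>j. column j X) ` ?J)"
      by (intro span_sum span_scale span_base imageI)
    finally have "(norm (\<mu> - lse X \<mu> ?J))\<^sup>2 \<le> (norm (X *v \<beta> - \<mu>))\<^sup>2"
      using norm_residual_le_span norm_minus_commute by metis
    then have "k * (norm (\<mu> - lse X \<mu> ?J))\<^sup>2 \<le> k * (norm (X *v \<beta> - \<mu>))\<^sup>2"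
      using k by (rule mult_left_mono)
    moreover have "\<kappa> * (lse_pen \<sigma> X ?J - lam * ln (sparsity_prior ?J) + lam * ln (1 / \<delta>))
        \<le> \<kappa> * (2 * (lam + 2 * \<sigma>\<^sup>2) * (l0 \<beta> * ?L))"
      using complexity_cost_le(1)[OF \<delta> lam, of \<sigma> X ?J] \<kappa> unfolding l0 by (rule mult_left_mono)
    moreover have "\<kappa> * 2 * (lam + 2 * \<sigma>\<^sup>2) * (l0 \<beta> * ?L) \<le> C * (l0 \<beta> * ?L)"
      using complexity_cost_le(2)[OF \<delta> lam, of ?J] \<open>l0 \<beta> \<ge> 1\<close> kC unfolding l0
      by (intro mult_right_mono) auto
    ultimately show ?thesis unfolding r_def by (simp add: mult.assoc)
  qed
  obtain J0 where J0: "\<And>J. r J0 \<le> r J"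
    using ex_min_if_finite[of "range r"] by (auto simp: not_less)
  have "r J0 \<le> (INF \<beta>. ?b \<beta>)"
    by (intro cINF_greatest) (auto intro: order_trans[OF J0 rb])
  then have "{\<omega> \<in> space M. Z \<omega> \<le> r J0} \<subseteq> {\<omega> \<in> space M. Z \<omega> \<le> (INF \<beta>. ?b \<beta>)}" by auto
  then have "measure M {\<omega> \<in> space M. Z \<omega> \<le> r J0} \<le> measure M {\<omega> \<in> space M. Z \<omega> \<le> (INF \<beta>. ?b \<beta>)}"
    using Z by (intro finite_measure_mono) auto
  then show ?thesis using dev[of J0] unfolding r_def by linarith
qed

lemma one_plus_over_one_minus_le:
  fixes s :: real
  assumes "0 \<le> s" "s \<le> 1 / 8"
  shows "(1 + s) / (1 - s) \<le> 1 + 16 / 3 * s"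
proof -
  have "0 \<le> s * (10 / 3 - 16 / 3 * s)" using assms by (intro mult_nonneg_nonneg) auto
  then have "1 + s \<le> (1 + 16 / 3 * s) * (1 - s)" by (simp add: algebra_simps)
  then show ?thesis using assms by (simp add: pos_divide_le_eq)
qed

lemma Q_aggregate_sparsity_oracle:
  fixes M :: "'a measure" and X :: "real^'p^'n" and \<mu> :: "real^'n" and \<xi> :: "'a \<Rightarrow> real^'n"
  assumes M: "prob_space M" and \<sigma>: "0 < \<sigma>" and iso: "iso_normal M \<sigma> \<xi>"
    and \<delta>: "0 < \<delta>" "\<delta> < 1" and lam: "18 * \<sigma>\<^sup>2 \<le> lam"
    and \<theta>: "\<And>\<omega>. \<omega> \<in> space M \<Longrightarrow> \<theta> \<omega> \<in> Q_weights (1 / 2) lam \<sigma> X (\<mu> + \<xi> \<omega>)"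
  shows "1 - \<delta> \<le> measure M {\<omega> \<in> space M.
      (norm (aggregate X (\<mu> + \<xi> \<omega>) (\<theta> \<omega>) - \<mu>))\<^sup>2
      \<le> (INF \<beta>. 1 * (norm (X *v \<beta> - \<mu>))\<^sup>2
          + 3 * (lam + 2 * \<sigma>\<^sup>2) * l0 \<beta> * ln (2 * exp 1 * real CARD('p) / (l0 \<beta> * \<delta>)))}"
proof (rule sparsity_oracle_deviation[where lam = lam and \<sigma> = \<sigma> and \<kappa> = 1, OF M _ \<delta>])
  have lam0: "lam > 0" using lam \<sigma> by (smt (verit) zero_less_power)
  then show "0 \<le> lam" "1 * 2 * (lam + 2 * \<sigma>\<^sup>2) \<le> 3 * (lam + 2 * \<sigma>\<^sup>2)"
    by auto
  have \<xi>m [measurable]: "\<xi> \<in> borel_measurable M" by (rule iso_normal_measurable[OF iso])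
  have [measurable]: "(\<lambda>\<omega>. aggregate X (\<mu> + \<xi> \<omega>) (\<theta> \<omega>)) \<in> borel_measurable M"
    by (rule borel_measurable_Q_aggregate[where \<nu> = "1 / 2" and lam = lam and \<sigma> = \<sigma>])
      (use \<theta> lam0 in auto)
  show Zm: "(\<lambda>\<omega>. (norm (aggregate X (\<mu> + \<xi> \<omega>) (\<theta> \<omega>) - \<mu>))\<^sup>2) \<in> borel_measurable M"
    by measurable
  fix K :: "'p set"
  define v where "v J = lse X \<mu> J - lse X \<mu> K" for J
  define w where "w J = 2 *\<^sub>R v J - (lse X (v J) J - lse X (v J) K)" for J
  have "\<sigma>\<^sup>2 * (norm (w J))\<^sup>2 \<le> lam * ((norm (v J))\<^sup>2 / 2)" for J
  proof -
    have "norm (w J) \<le> norm (2 *\<^sub>R v J) + norm (lse X (v J) J - lse X (v J) K)"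
      unfolding w_def by (rule norm_triangle_ineq4)
    also have "\<dots> \<le> 3 * norm (v J)" using norm_lse_diff_le[of X "v J" J K] by simp
    finally have "(norm (w J))\<^sup>2 \<le> (3 * norm (v J))\<^sup>2" by (rule power_mono) simp
    then have "\<sigma>\<^sup>2 * (norm (w J))\<^sup>2 \<le> \<sigma>\<^sup>2 * (3 * norm (v J))\<^sup>2" by (rule mult_left_mono) simp
    also have "\<dots> = (18 * \<sigma>\<^sup>2) * ((norm (v J))\<^sup>2 / 2)" by (simp add: power_mult_distrib)
    also have "\<dots> \<le> lam * ((norm (v J))\<^sup>2 / 2)" using lam by (rule mult_right_mono) simp
    finally show ?thesis .
  qed
  moreover have "16 * \<sigma>\<^sup>2 \<le> lam" using lam by (smt (verit) zero_le_power2)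
  moreover have "(norm (aggregate X (\<mu> + \<xi> \<omega>) (\<theta> \<omega>) - \<mu>))\<^sup>2
    \<le> ((norm (\<mu> - lse X \<mu> K))\<^sup>2 + lse_pen \<sigma> X K - lam * ln (sparsity_prior K))
      + log_partition lam (noise_potential \<sigma> X w (\<lambda>J. (norm (v J))\<^sup>2 / 2) (\<xi> \<omega>))"
    if "\<omega> \<in> space M" for \<omega>
    using Q_aggregate_oracle[OF \<theta>[OF that] lam0, of K] unfolding w_def v_def by simp
  ultimately have "1 - \<delta> \<le> measure M {\<omega> \<in> space M.
      (norm (aggregate X (\<mu> + \<xi> \<omega>) (\<theta> \<omega>) - \<mu>))\<^sup>2
      \<le> ((norm (\<mu> - lse X \<mu> K))\<^sup>2 + lse_pen \<sigma> X K - lam * ln (sparsity_prior K)) + lam * ln (1 / \<delta>)}"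
    by (intro log_partition_deviation[OF M \<sigma> iso _ _ \<delta>(1) Zm])
  then show "1 - \<delta> \<le> measure M {\<omega> \<in> space M.
      (norm (aggregate X (\<mu> + \<xi> \<omega>) (\<theta> \<omega>) - \<mu>))\<^sup>2 \<le> 1 * (norm (\<mu> - lse X \<mu> K))\<^sup>2
        + 1 * (lse_pen \<sigma> X K - lam * ln (sparsity_prior K) + lam * ln (1 / \<delta>))}"
    by (simp add: algebra_simps)
qed auto

lemma EW_sparsity_oracle:
  fixes M :: "'a measure" and X :: "real^'p^'n" and \<mu> :: "real^'n" and \<xi> :: "'a \<Rightarrow> real^'n"
  assumes M: "prob_space M" and \<sigma>: "0 < \<sigma>" and iso: "iso_normal M \<sigma> \<xi>"
    and \<delta>: "0 < \<delta>" "\<delta> < 1" and lam: "64 * \<sigma>\<^sup>2 \<le> lam"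
  shows "1 - \<delta> \<le> measure M {\<omega> \<in> space M.
      (norm (aggregate X (\<mu> + \<xi> \<omega>) (EW_weights lam \<sigma> X (\<mu> + \<xi> \<omega>)) - \<mu>))\<^sup>2
      \<le> (INF \<beta>. (1 + 128 * \<sigma>\<^sup>2 / (3 * lam)) * (norm (X *v \<beta> - \<mu>))\<^sup>2
          + 6 * (lam + 2 * \<sigma>\<^sup>2) * l0 \<beta> * ln (2 * exp 1 * real CARD('p) / (l0 \<beta> * \<delta>)))}"
proof -
  let ?Z = "\<lambda>\<omega>. (norm (aggregate X (\<mu> + \<xi> \<omega>) (EW_weights lam \<sigma> X (\<mu> + \<xi> \<omega>)) - \<mu>))\<^sup>2"
  have lam0: "lam > 0" using lam \<sigma> by (smt (verit) zero_less_power)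
  \<comment> \<open>The smallest share of the biases that dominates the linear noise with \<open>w\<^sub>J = 2 (b\<^sub>K - b\<^sub>J)\<close>.\<close>
  define s where "s = 8 * \<sigma>\<^sup>2 / lam"
  have s: "0 \<le> s" "s \<le> 1 / 8" using lam lam0 by (auto simp: s_def field_simps)
  have [measurable]: "\<xi> \<in> borel_measurable M" by (rule iso_normal_measurable[OF iso])
  have [measurable]: "(\<lambda>y. aggregate X y (EW_weights lam \<sigma> X y)) \<in> borel_measurable borel"
    by (rule borel_measurable_continuous_onI[OF continuous_on_EW_aggregate])
  have [measurable]: "(\<lambda>\<omega>. aggregate X (\<mu> + \<xi> \<omega>) (EW_weights lam \<sigma> X (\<mu> + \<xi> \<omega>))) \<in> borel_measurable M"
    by (rule measurable_compose[of "\<lambda>\<omega>. \<mu> + \<xi> \<omega>" M borel]) measurable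
  have Zm: "?Z \<in> borel_measurable M" by measurable
  have k: "(1 + s) / (1 - s) \<le> 1 + 128 * \<sigma>\<^sup>2 / (3 * lam)"
    using one_plus_over_one_minus_le[OF s] by (simp add: s_def)
  show ?thesis
  proof (rule sparsity_oracle_deviation[where lam = lam and \<sigma> = \<sigma> and \<kappa> = "1 / (1 - s)", OF M Zm \<delta>])
    show "0 \<le> 1 / (1 - s)" "0 \<le> lam" "0 \<le> 1 + 128 * \<sigma>\<^sup>2 / (3 * lam)"
      using s lam0 by auto
    show "1 / (1 - s) * 2 * (lam + 2 * \<sigma>\<^sup>2) \<le> 6 * (lam + 2 * \<sigma>\<^sup>2)"
    proof (rule mult_right_mono)
      show "1 / (1 - s) * 2 \<le> 6" using s by (simp add: field_simps)
    qed (use lam0 in auto)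
    fix K :: "'p set"
    define b where "b J = \<mu> - lse X \<mu> J" for J
    let ?w = "\<lambda>J. 2 *\<^sub>R (b K - b J)" and ?c = "\<lambda>J. s * ((norm (b K))\<^sup>2 + (norm (b J))\<^sup>2)"
    let ?r = "(1 + s) * (norm (b K))\<^sup>2 + lse_pen \<sigma> X K - lam * ln (sparsity_prior K)"
    have "\<sigma>\<^sup>2 * (norm (?w J))\<^sup>2 \<le> lam * ?c J" for J
    proof -
      have "(norm (b K - b J))\<^sup>2 \<le> (norm (b K) + norm (b J))\<^sup>2"
        by (intro power_mono norm_triangle_ineq4) simp
      also have "\<dots> \<le> 2 * ((norm (b K))\<^sup>2 + (norm (b J))\<^sup>2)"
        using sum_squares_bound[of "norm (b K)" "norm (b J)"] by (simp add: power2_sum)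
      finally have "4 * \<sigma>\<^sup>2 * (norm (b K - b J))\<^sup>2
          \<le> 4 * \<sigma>\<^sup>2 * (2 * ((norm (b K))\<^sup>2 + (norm (b J))\<^sup>2))"
        by (rule mult_left_mono) simp
      then show ?thesis using lam0 by (simp add: s_def power_mult_distrib distrib_left)
    qed
    moreover have "16 * \<sigma>\<^sup>2 \<le> lam" using lam by (smt (verit) zero_le_power2)
    moreover have "(1 - s) * ?Z \<omega> \<le> ?r + log_partition lam (noise_potential \<sigma> X ?w ?c (\<xi> \<omega>))" for \<omega>
      using EW_oracle[OF lam0, of s X \<mu> "\<xi> \<omega>" \<sigma> K] s unfolding b_def by simp
    moreover have "(\<lambda>\<omega>. (1 - s) * ?Z \<omega>) \<in> borel_measurable M" by measurable
    ultimately have "1 - \<delta> \<le> measure M {\<omega> \<in> space M. (1 - s) * ?Z \<omega> \<le> ?r + lam * ln (1 / \<delta>)}"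
      by (intro log_partition_deviation[OF M \<sigma> iso _ _ \<delta>(1)])
    also have "\<dots> \<le> measure M {\<omega> \<in> space M. ?Z \<omega> \<le> (1 + 128 * \<sigma>\<^sup>2 / (3 * lam)) * (norm (\<mu> - lse X \<mu> K))\<^sup>2
        + 1 / (1 - s) * (lse_pen \<sigma> X K - lam * ln (sparsity_prior K) + lam * ln (1 / \<delta>))}"
    proof (rule finite_measure.finite_measure_mono)
      show "finite_measure M" using M by (simp add: prob_space_def)
      show "{\<omega> \<in> space M. (1 - s) * ?Z \<omega> \<le> ?r + lam * ln (1 / \<delta>)}
        \<subseteq> {\<omega> \<in> space M. ?Z \<omega> \<le> (1 + 128 * \<sigma>\<^sup>2 / (3 * lam)) * (norm (\<mu> - lse X \<mu> K))\<^sup>2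
          + 1 / (1 - s) * (lse_pen \<sigma> X K - lam * ln (sparsity_prior K) + lam * ln (1 / \<delta>))}"
      proof
        fix \<omega> assume \<omega>: "\<omega> \<in> {\<omega> \<in> space M. (1 - s) * ?Z \<omega> \<le> ?r + lam * ln (1 / \<delta>)}"
        then have "?Z \<omega> \<le> (?r + lam * ln (1 / \<delta>)) / (1 - s)"
          using s by (simp add: pos_le_divide_eq mult.commute)
        also have "\<dots> = (1 + s) / (1 - s) * (norm (b K))\<^sup>2
            + 1 / (1 - s) * (lse_pen \<sigma> X K - lam * ln (sparsity_prior K) + lam * ln (1 / \<delta>))"
          unfolding times_divide_eq_left add_divide_distrib[symmetric] by simp
        also have "(1 + s) / (1 - s) * (norm (b K))\<^sup>2 \<le> (1 + 128 * \<sigma>\<^sup>2 / (3 * lam)) * (norm (b K))\<^sup>2"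
          using k by (rule mult_right_mono) simp
        finally show "\<omega> \<in> {\<omega> \<in> space M. ?Z \<omega> \<le> (1 + 128 * \<sigma>\<^sup>2 / (3 * lam)) * (norm (\<mu> - lse X \<mu> K))\<^sup>2
          + 1 / (1 - s) * (lse_pen \<sigma> X K - lam * ln (sparsity_prior K) + lam * ln (1 / \<delta>))}"
          using \<omega> by (simp add: b_def)
      qed
    qed (use Zm in measurable)
    finally show "1 - \<delta> \<le> measure M {\<omega> \<in> space M. ?Z \<omega> \<le> (1 + 128 * \<sigma>\<^sup>2 / (3 * lam)) * (norm (\<mu> - lse X \<mu> K))\<^sup>2
        + 1 / (1 - s) * (lse_pen \<sigma> X K - lam * ln (sparsity_prior K) + lam * ln (1 / \<delta>))}" .
  qed
qed


theorem theorem3: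
  fixes M :: "'a measure" and X :: "real^'p^'n" and \<mu> :: "real^'n"
    and \<xi> Y :: "'a \<Rightarrow> real^'n" and \<sigma> \<delta> :: real
  assumes "prob_space M"
    and "\<sigma> > 0"
    and "\<delta> > 0"
    and "iso_normal M \<sigma> \<xi>"
    and "\<And>\<omega>. \<omega> \<in> space M \<Longrightarrow> Y \<omega> = \<mu> + \<xi> \<omega>"
  shows
    "(\<forall>lam \<theta>. lam \<ge> 20 * \<sigma>\<^sup>2 \<longrightarrow>
        (\<forall>\<omega>\<in>space M. \<theta> \<omega> \<in> Q_weights (1 / 2) lam \<sigma> X (Y \<omega>)) \<longrightarrow>
        measure M {\<omega> \<in> space M.
            (norm (aggregate X (Y \<omega>) (\<theta> \<omega>) - \<mu>))\<^sup>2
            \<le> (INF \<beta>. (norm (X *v \<beta> - \<mu>))\<^sup>2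
                 + 3 * (lam + 2 * \<sigma>\<^sup>2) * l0 \<beta>
                   * ln (2 * exp 1 * real CARD('p) / (l0 \<beta> * \<delta>)))}
          \<ge> 1 - \<delta>)
     \<and>
     (\<forall>lam. lam \<ge> 64 * \<sigma>\<^sup>2 \<longrightarrow>
        measure M {\<omega> \<in> space M.
            (norm (aggregate X (Y \<omega>) (EW_weights lam \<sigma> X (Y \<omega>)) - \<mu>))\<^sup>2
            \<le> (INF \<beta>. (1 + 128 * \<sigma>\<^sup>2 / (3 * lam)) * (norm (X *v \<beta> - \<mu>))\<^sup>2
                 + 6 * (lam + 2 * \<sigma>\<^sup>2) * l0 \<beta>
                   * ln (2 * exp 1 * real CARD('p) / (l0 \<beta> * \<delta>)))}
          \<ge> 1 - \<delta>)"
proof (cases "\<delta> < 1")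
  case True
  have shift: "{\<omega> \<in> space M. P (Y \<omega>) \<omega>} = {\<omega> \<in> space M. P (\<mu> + \<xi> \<omega>) \<omega>}" for P
    using assms(5) by auto
  show ?thesis
  proof (intro conjI allI impI)
    fix lam :: real and \<theta>
    assume lam: "20 * \<sigma>\<^sup>2 \<le> lam"
      and \<theta>: "\<forall>\<omega>\<in>space M. \<theta> \<omega> \<in> Q_weights (1 / 2) lam \<sigma> X (Y \<omega>)"
    have "18 * \<sigma>\<^sup>2 \<le> lam" using lam zero_le_power2[of \<sigma>] by linarith
    moreover have "\<theta> \<omega> \<in> Q_weights (1 / 2) lam \<sigma> X (\<mu> + \<xi> \<omega>)" if "\<omega> \<in> space M" for \<omega>
      using \<theta> assms(5)[OF that] that by auto
    ultimately show "1 - \<delta> \<le> measure M {\<omega> \<in> space M.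
        (norm (aggregate X (Y \<omega>) (\<theta> \<omega>) - \<mu>))\<^sup>2
        \<le> (INF \<beta>. (norm (X *v \<beta> - \<mu>))\<^sup>2
             + 3 * (lam + 2 * \<sigma>\<^sup>2) * l0 \<beta>
               * ln (2 * exp 1 * real CARD('p) / (l0 \<beta> * \<delta>)))}"
      using Q_aggregate_sparsity_oracle[OF assms(1,2,4,3) True, of lam \<theta> X \<mu>]
      unfolding shift[of "\<lambda>y \<omega>. (norm (aggregate X y (\<theta> \<omega>) - \<mu>))\<^sup>2 \<le> _"] mult_1 by blast
  next
    fix lam :: real
    assume lam: "64 * \<sigma>\<^sup>2 \<le> lam"
    show "1 - \<delta> \<le> measure M {\<omega> \<in> space M.
        (norm (aggregate X (Y \<omega>) (EW_weights lam \<sigma> X (Y \<omega>)) - \<mu>))\<^sup>2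
        \<le> (INF \<beta>. (1 + 128 * \<sigma>\<^sup>2 / (3 * lam)) * (norm (X *v \<beta> - \<mu>))\<^sup>2
             + 6 * (lam + 2 * \<sigma>\<^sup>2) * l0 \<beta>
               * ln (2 * exp 1 * real CARD('p) / (l0 \<beta> * \<delta>)))}"
      unfolding shift[of "\<lambda>y \<omega>. (norm (aggregate X y (EW_weights lam \<sigma> X y) - \<mu>))\<^sup>2 \<le> _"]
      by (rule EW_sparsity_oracle[OF assms(1,2,4,3) True lam])
  qed
next
  case False
  then have "1 - \<delta> \<le> measure M A" for A
    using measure_nonneg[of M A] by linarith
  then show ?thesis by blast
qed

end
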